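(* Let $p\geq 1$ and let $\{a_n\}_{n=0}^\infty$ be a sequence such that the sequence $\{f_n\}_{n=0}^\infty$, $f_n=n^p a_n$, of real numbers satisfies the Hausdorff-type condition: there exist constants $M>0$ and $\epsilon>0$ with $$(n+1)^{(1+\epsilon)}\sum_{i=0}^n \binom{n}{i}^{(2+\epsilon)} \left|\Delta^i f_{n-i}\right|^{(2+\epsilon)} < M \qquad (n=0,1,2,\ldots).$$ Then there exists a unique Carlsonian interpolation of the numbers $a_n$, denoted by $\tilde a(\lambda)$ ($\lambda\in\mathbb{C}$, $\tilde a(n)=a_n$ for $n=0,1,2,\ldots$), that satisfies the following conditions: (i) $\tilde a(\lambda)$ is holomorphic in the half-plane $\mathrm{Re}\,\lambda>-1/2$ and continuous at $\mathrm{Re}\,\lambda=-1/2$; (ii) $\lambda^p\tilde a(\lambda)$ belongs to $L^2(-\infty,+\infty)$ for any fixed value of $\mathrm{Re}\,\lambda\geq -1/2$, i.e., putting $\lambda=\sigma+i\nu$, $\int_{-\infty}^{+\infty}\left|(\sigma+i\nu)^p\,\tilde a(\sigma+i\nu)\right|^2 d\nu<\infty$ for every $\sigma\geq -1/2$; (iii) $\lambda^p\tilde a(\lambda)$ tends uniformly to zero as $\lambda$ tends to infinity inside any fixed half-plane $\mathrm{Re}\,\lambda\geq\delta>-1/2$; (iv) $\lambda^{p-1}\tilde a(\lambda)$ belongs to $L^1(-\infty,+\infty)$, as a function of $\nu=\mathrm{Im}\,\lambda$, for any fixed value of $\mathrm{Re}\,\lambda\geq -1/2$.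
   Context: $\Delta$ is the difference operator $\Delta f_n=f_{n+1}-f_n$, with $\Delta^0$ the identity and $\Delta^k f_n=\sum_{m=0}^k(-1)^m\binom{k}{m}f_{n+k-m}$. A Carlsonian interpolation of $\{a_n\}$ is a function $\tilde a(\lambda)$ on the half-plane $\mathrm{Re}\,\lambda>-1/2$ with $\tilde a(n)=a_n$ for $n=0,1,2,\ldots$, lying in a class of functions to which Carlson's uniqueness theorem applies (here: $\lambda^p\tilde a(\lambda)$ belongs to the Hardy space $\mathbb{H}^2$ of the half-plane $\mathrm{Re}\,\lambda>-1/2$), so that it is determined by its values at the non-negative integers.
   Formalization: p is an integer. As f_0=0 ignores a_0, the claim can fail at λ=0 (p=1, a_0=1, other a_n=0). Proved: it holds as printed iff F(x)/x^p→a_0 as x→0+, F the Newton series of f; without this, all holds except that holomorphy and continuity in (i) are required only off λ=0. *)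

theory Defs
  imports "HOL-Complex_Analysis.Complex_Analysis"
begin

definition fdiff :: "(nat \<Rightarrow> 'a::ab_group_add) \<Rightarrow> nat \<Rightarrow> 'a" where
  "fdiff f n = f (Suc n) - f n"

lemma funpow_fdiff_eq_sum:
  fixes f :: "nat \<Rightarrow> 'a::comm_ring_1"
  shows "(fdiff ^^ k) f n = (\<Sum>m\<le>k. (-1) ^ m * of_nat (k choose m) * f (n + k - m))"
proof (induction k arbitrary: n)
  case 0
  show ?case by simp
next
  case (Suc k)
  let ?A = "\<lambda>m. (-1) ^ m * of_nat (k choose m) * f (n + Suc k - m)"
  let ?B = "\<lambda>m. (-1) ^ m * of_nat (k choose m) * f (n + k - m)"
  have "(\<Sum>m\<le>Suc k. (-1) ^ m * of_nat (Suc k choose m) * f (n + Suc k - m))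
      = f (n + Suc k) + (\<Sum>m\<le>k. ?A (Suc m) - ?B m)"
    by (subst sum.atMost_Suc_shift) (auto intro!: sum.cong simp: algebra_simps)
  also have "\<dots> = (\<Sum>m\<le>Suc k. ?A m) - (\<Sum>m\<le>k. ?B m)"
    by (subst sum.atMost_Suc_shift) (simp add: sum_subtractf)
  also have "\<dots> = (\<Sum>m\<le>k. ?A m) - (\<Sum>m\<le>k. ?B m)"
    by (simp add: binomial_eq_0)
  also have "\<dots> = (fdiff ^^ Suc k) f n"
    using Suc[of "Suc n"] Suc[of n] by (simp add: fdiff_def[of "(fdiff ^^ k) f"])
  finally show ?case by simp
qed

definition hausdorff_condition :: "(nat \<Rightarrow> real) \<Rightarrow> bool" where
  "hausdorff_condition f \<longleftrightarrow> (\<exists>M>0. \<exists>\<epsilon>>0. \<forall>n.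
     (real n + 1) powr (1 + \<epsilon>) *
       (\<Sum>i\<le>n. real (n choose i) powr (2 + \<epsilon>) * \<bar>(fdiff ^^ i) f (n - i)\<bar> powr (2 + \<epsilon>)) < M)"

definition hardy2 :: "real \<Rightarrow> (complex \<Rightarrow> complex) \<Rightarrow> bool" where
  "hardy2 c F \<longleftrightarrow> F holomorphic_on {z. Re z > c} \<and>
     (\<exists>C. \<forall>\<sigma>>c. (\<integral>\<^sup>+\<nu>. ennreal ((cmod (F (Complex \<sigma> \<nu>)))\<^sup>2) \<partial>lborel) \<le> ennreal C)"

definition carlsonian_interpolation ::
    "nat \<Rightarrow> (nat \<Rightarrow> real) \<Rightarrow> (complex \<Rightarrow> complex) \<Rightarrow> bool" where
  "carlsonian_interpolation p a g \<longleftrightarrow>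
     (\<forall>n. g (of_nat n) = of_real (a n)) \<and> hardy2 (-1/2) (\<lambda>z. z ^ p * g z)"

text \<open>
  \<open>E\<close> is a set of points at which regularity of \<open>g\<close> is not required. It is only
  used with \<open>E = {}\<close> and with \<open>E = {0}\<close>. In the second case \<open>z ^ p * g z\<close> is still
  holomorphic at \<open>0\<close> by \<open>hardy2\<close>, so \<open>g\<close> has at most a pole there.
\<close>

definition regular_interpolation ::
    "nat \<Rightarrow> (nat \<Rightarrow> real) \<Rightarrow> complex set \<Rightarrow> (complex \<Rightarrow> complex) \<Rightarrow> bool" where
  "regular_interpolation p a E g \<longleftrightarrow>
     carlsonian_interpolation p a g \<and>
     g holomorphic_on {z. Re z > -1/2} - E \<and>
     continuous_on ({z. Re z \<ge> -1/2} - E) g \<and>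
     (\<forall>\<sigma>\<ge>-1/2. integrable lborel
        (\<lambda>\<nu>. (cmod (Complex \<sigma> \<nu> ^ p * g (Complex \<sigma> \<nu>)))\<^sup>2)) \<and>
     (\<forall>\<delta>>-1/2. ((\<lambda>z. z ^ p * g z) \<longlongrightarrow> 0) (inf at_infinity (principal {z. Re z \<ge> \<delta>}))) \<and>
     (\<forall>\<sigma>\<ge>-1/2. integrable lborel
        (\<lambda>\<nu>. Complex \<sigma> \<nu> ^ (p - 1) * g (Complex \<sigma> \<nu>)))"

definition exists_unique_regular_interpolation ::
    "nat \<Rightarrow> (nat \<Rightarrow> real) \<Rightarrow> complex set \<Rightarrow> bool" where
  "exists_unique_regular_interpolation p a E \<longleftrightarrow>
     (\<exists>g. regular_interpolation p a E g \<and>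
       (\<forall>h. regular_interpolation p a E h \<longrightarrow> (\<forall>z. Re z \<ge> -1/2 \<longrightarrow> h z = g z)))"

text \<open>
  The sequence \<open>f n = n ^ p * a n\<close> does not depend on \<open>a 0\<close>, and its interpolation
  \<open>F\<close> in the Hardy space may vanish at \<open>0\<close> to an order less than \<open>p\<close>; then \<open>F z / z ^ p\<close>
  has a pole at \<open>0\<close>, or takes there a value other than \<open>a 0\<close>. The next condition
  expresses through the data alone that neither happens: for real \<open>x > 0\<close> the Newton
  series of \<open>f\<close> converges to \<open>F x\<close>.
\<close>

definition newton_series :: "(nat \<Rightarrow> real) \<Rightarrow> real \<Rightarrow> real" where
  "newton_series f x = (\<Sum>k. (x gchoose k) * (fdiff ^^ k) f 0)"

definition compatible_at_zero :: "nat \<Rightarrow> (nat \<Rightarrow> real) \<Rightarrow> bool" where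
  "compatible_at_zero p a \<longleftrightarrow>
     ((\<lambda>x. newton_series (\<lambda>n. real n ^ p * a n) x / x ^ p) \<longlongrightarrow> a 0) (at_right 0)"

end

theory Submission
  imports Defs "HOL-Probability.Sinc_Integral"
begin

text \<open>
  Write \<open>f n = n ^ p * a n\<close>. The Hausdorff-type condition is the \<open>L\<^sup>q\<close> bound, \<open>q = 2 + \<epsilon>\<close>, of
  Hausdorff's moment problem: it says that \<open>f n\<close> ought to be \<open>\<integral>\<^sub>0\<^sup>1 x ^ n * u x dx\<close> for some
  \<open>u\<close> in \<open>L\<^sup>q\<close>, and then \<open>F z = \<integral>\<^sub>0\<^sup>1 x powr z * u x dx\<close> interpolates \<open>f\<close>. Because \<open>q > 2\<close>,
  the function \<open>u\<close> is still square integrable against a weight \<open>x powr (-s)\<close> with \<open>s > 0\<close>, so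
  that \<open>F\<close> is holomorphic, with uniformly bounded \<open>L\<^sup>2\<close> norms on vertical lines, in the half-plane
  \<open>Re z > - (1 + s) / 2\<close>. The line \<open>Re z = -1/2\<close> is therefore an interior line of the domain, and
  all boundary regularity at \<open>Re z = -1/2\<close> comes for free.

  The density \<open>u\<close> itself is never constructed. Its place is taken by the Durrmeyer polynomials
  \<open>U n\<close> of the moment sequence. Their weighted \<open>L\<^sup>2\<close> norms are bounded by the Hausdorff constant
  (\<open>durrmeyer_weighted_bound\<close>), and their moments converge to \<open>f\<close> (\<open>mellin_durrmeyer_limit\<close>).
  The Mellin transform of a polynomial is a rational function, for which Plancherel's identity is a
  partial fraction computation (\<open>mellin_Plancherel\<close>). Montel's theorem then yields \<open>F\<close> as a limit
  of these transforms, and the bounds survive by Fatou's lemma (\<open>hausdorff_interpolation\<close>). The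
  remainder of the binomial series of \<open>x \<mapsto> t powr x\<close> is uniform in \<open>t\<close>, so the same passage to
  the limit identifies the Newton series of \<open>f\<close> with \<open>F\<close> on the interval \<open>(0, 1)\<close>.

  By Cauchy's estimate, boundedness of \<open>F\<close> on a larger half-plane makes \<open>F\<close> uniformly continuous;
  being also square integrable on every line, \<open>F\<close> tends to \<open>0\<close> at infinity
  (\<open>half_plane_decay\<close>). Division by \<open>z\<close> and the inequality between the arithmetic and the geometric
  mean give integrability of \<open>F z / z\<close> on lines.

  Uniqueness: by the decay condition, the product \<open>D\<close> of \<open>z ^ p\<close> with the difference
  of two candidates is bounded on \<open>Re z > 0\<close> and vanishes at all positive integers. Splitting off zeros with
  the Schwarz lemma bounds \<open>D\<close> by a Blaschke product that tends to \<open>0\<close> because the harmonic series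
  diverges (\<open>bounded_vanishing_at_positive_integers\<close>).

  Finally \<open>g z = F z / z ^ p\<close>, with \<open>g 0 = a 0\<close>, is the only candidate. It has all the properties
  away from \<open>0\<close>; it is regular at \<open>0\<close> exactly if \<open>F z / z ^ p\<close> has a removable singularity with value
  \<open>a 0\<close> there, and this can be read off from the limit along positive reals
  (\<open>divide_power_holomorphic\<close>), where \<open>F\<close> is the Newton series.
\<close>


section \<open>Mellin transforms of polynomials on the unit interval\<close>

lemma has_integral_powr_complex:
  fixes w :: complex
  assumes "Re w > 0"
  shows "((\<lambda>x::real. of_real x powr (w - 1)) has_integral 1 / w) {0<..<1}"
proof -
  have w: "w \<noteq> 0"
    using assms by auto
  have "((\<lambda>x::real. of_real x powr (w - 1)) has_integral
      (of_real 1 powr w / w - of_real 0 powr w / w)) {0..1}"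
  proof (rule fundamental_theorem_of_calculus_interior)
    show "continuous_on {0..1} (\<lambda>x::real. complex_of_real x powr w / w)"
      using assms w by (intro continuous_intros continuous_on_powr_complex) auto
    show "((\<lambda>x::real. complex_of_real x powr w / w) has_vector_derivative
        of_real x powr (w - 1)) (at x)" if "x \<in> {0<..<1}" for x
    proof (rule has_vector_derivative_real_field)
      show "((\<lambda>z. z powr w / w) has_field_derivative of_real x powr (w - 1)) (at (complex_of_real x))"
        using that w by (auto intro!: derivative_eq_intros has_field_derivative_powr)
    qed
  qed auto
  then show ?thesis
    by (simp add: has_integral_Icc_iff_Ioo)
qed

lemma has_integral_powr_mult_power:
  fixes r :: real
  assumes "r + real k > -1"
  shows "((\<lambda>x. x powr r * x ^ k) has_integral 1 / (r + real k + 1)) {0<..<1}"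
proof -
  have "((\<lambda>x. x powr (r + real k)) has_integral 1 / (r + real k + 1)) {0<..<1}"
    using has_integral_powr_from_0[of "r + real k" 1] assms by (simp add: has_integral_Icc_iff_Ioo)
  moreover have "x powr r * x ^ k = x powr (r + real k)" if "x \<in> {0<..<1}" for x :: real
    using that by (simp add: powr_add powr_realpow)
  ultimately show ?thesis
    by (subst has_integral_cong) auto
qed

text \<open>
  The values \<open>\<integral>\<^sub>0\<^sup>1 x powr z * poly u x dx\<close>, given by the closed formula that continues them to the
  whole plane as a rational function; see \<open>mellin_has_integral\<close>.
\<close>

definition mellin :: "real poly \<Rightarrow> complex \<Rightarrow> complex" where
  "mellin u z = (\<Sum>m\<le>degree u. of_real (coeff u m) / (z + of_nat (Suc m)))"

lemma mellin_has_integral: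
  assumes "Re z > -1"
  shows "((\<lambda>x. of_real x powr z * of_real (poly u x)) has_integral mellin u z) {0<..<1}"
proof -
  have "((\<lambda>x::real. \<Sum>m\<le>degree u. of_real (coeff u m) * of_real x powr (z + of_nat (Suc m) - 1))
      has_integral (\<Sum>m\<le>degree u. of_real (coeff u m) * (1 / (z + of_nat (Suc m))))) {0<..<1}"
    using assms
    by (intro has_integral_sum has_integral_mult_right has_integral_powr_complex) auto
  moreover have "(\<Sum>m\<le>degree u. of_real (coeff u m) * of_real x powr (z + of_nat (Suc m) - 1))
      = of_real x powr z * of_real (poly u x)" if "x \<in> {0<..<1}" for x :: real
  proof -
    have "of_real x powr (z + of_nat (Suc m) - 1) = of_real x powr z * complex_of_real (x ^ m)" for m
      using that by (simp add: powr_add algebra_simps powr_nat')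
    then show ?thesis
      by (simp add: poly_altdef sum_distrib_left mult_ac)
  qed
  ultimately show ?thesis
    unfolding mellin_def by (subst has_integral_cong[symmetric]) auto
qed

lemma has_integral_powr_mult_poly:
  fixes r :: real
  assumes "r > -1"
  shows "((\<lambda>x. x powr r * poly p x) has_integral (\<Sum>m\<le>degree p. coeff p m / (r + real m + 1))) {0<..<1}"
proof -
  have "((\<lambda>x. \<Sum>m\<le>degree p. coeff p m * (x powr r * x ^ m)) has_integral
      (\<Sum>m\<le>degree p. coeff p m * (1 / (r + real m + 1)))) {0<..<1}"
    using assms by (intro has_integral_sum has_integral_mult_right has_integral_powr_mult_power) auto
  then show ?thesis
    by (simp add: poly_altdef sum_distrib_left mult_ac)
qed

lemma mellin_holomorphic: "mellin u holomorphic_on {z. Re z > -1}"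
  unfolding mellin_def by (intro holomorphic_intros) (auto simp: complex_eq_iff)

text \<open>
  The Poisson kernel of the half-plane has total mass \<open>pi\<close>; this is the only integral over the real
  line that Plancherel's identity for rational functions needs.
\<close>

lemma has_bochner_integral_Poisson:
  assumes "A > 0"
  shows "has_bochner_integral lborel (\<lambda>v::real. A / (A\<^sup>2 + v\<^sup>2)) pi"
proof -
  have "has_bochner_integral lborel (\<lambda>x::real. inverse (1 + x\<^sup>2)) pi"
    using integrable_inverse_1_plus_square LBINT_inverse_1_plus_square
    by (simp add: has_bochner_integral_iff set_integrable_def interval_lebesgue_integral_def
        set_lebesgue_integral_def)
  then have "has_bochner_integral lborel (\<lambda>v. inverse (1 + (0 + (1 / A) * v)\<^sup>2)) (pi /\<^sub>R \<bar>1 / A\<bar>)"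
    using assms lborel_has_bochner_integral_real_affine_iff[of "1 / A" "\<lambda>x. inverse (1 + x\<^sup>2)" pi 0]
    by simp
  then have "has_bochner_integral lborel (\<lambda>v. (1 / A) * inverse (1 + (0 + (1 / A) * v)\<^sup>2))
      ((1 / A) * (pi /\<^sub>R \<bar>1 / A\<bar>))"
    by (rule has_bochner_integral_mult_right)
  also have "(1 / A) * (pi /\<^sub>R \<bar>1 / A\<bar>) = pi"
    using assms by simp
  also have "(\<lambda>v. (1 / A) * inverse (1 + (0 + (1 / A) * v)\<^sup>2)) = (\<lambda>v. A / (A\<^sup>2 + v\<^sup>2))"
  proof
    fix v
    have "A\<^sup>2 + v\<^sup>2 > 0"
      using assms by (simp add: sum_power2_gt_zero_iff)
    then show "(1 / A) * inverse (1 + (0 + (1 / A) * v)\<^sup>2) = A / (A\<^sup>2 + v\<^sup>2)"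
      using assms by (simp add: field_simps power2_eq_square)
  qed
  finally show ?thesis .
qed

text \<open>
  Only the real part of \<open>1 / (A + \<i>v) * 1 / (B - \<i>v)\<close> contributes to a squared modulus, and it splits
  into two Poisson kernels. This avoids Fourier inversion in Plancherel's identity.
\<close>

lemma Re_partial_fraction:
  fixes A B v :: real
  assumes "A > 0" "B > 0"
  shows "Re (1 / Complex A v * cnj (1 / Complex B v))
       = (A / (A\<^sup>2 + v\<^sup>2) + B / (B\<^sup>2 + v\<^sup>2)) / (A + B)"
proof -
  have pos: "A\<^sup>2 + v\<^sup>2 > 0" "B\<^sup>2 + v\<^sup>2 > 0" "A + B > 0"
    using assms by (simp_all add: sum_power2_gt_zero_iff)
  have "Re (1 / Complex A v * cnj (1 / Complex B v)) = (A * B + v\<^sup>2) / ((A\<^sup>2 + v\<^sup>2) * (B\<^sup>2 + v\<^sup>2))"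
    using pos by (simp add: Re_divide Im_divide) (simp add: field_simps power2_eq_square)
  also have "\<dots> = (A / (A\<^sup>2 + v\<^sup>2) + B / (B\<^sup>2 + v\<^sup>2)) / (A + B)"
  proof -
    have "A / (A\<^sup>2 + v\<^sup>2) + B / (B\<^sup>2 + v\<^sup>2)
        = (A * (B\<^sup>2 + v\<^sup>2) + B * (A\<^sup>2 + v\<^sup>2)) / ((A\<^sup>2 + v\<^sup>2) * (B\<^sup>2 + v\<^sup>2))"
      using pos by (intro add_frac_eq) auto
    also have "A * (B\<^sup>2 + v\<^sup>2) + B * (A\<^sup>2 + v\<^sup>2) = (A * B + v\<^sup>2) * (A + B)"
      by (simp add: algebra_simps power2_eq_square)
    finally have "A / (A\<^sup>2 + v\<^sup>2) + B / (B\<^sup>2 + v\<^sup>2) = (A * B + v\<^sup>2) * (A + B) / ((A\<^sup>2 + v\<^sup>2) * (B\<^sup>2 + v\<^sup>2))" .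
    then show ?thesis
      using pos by simp
  qed
  finally show ?thesis .
qed

text \<open>
  Expand the square on both sides as a double sum over the coefficients. The integral of
  \<open>x powr (2 * s + 1) * x ^ (m + l)\<close> is \<open>1 / (A m + A l)\<close> with \<open>A m = s + m + 1\<close>, and the line integral of
  the corresponding product of simple fractions is \<open>2 * pi\<close> times this number.
\<close>

lemma mellin_Plancherel:
  assumes s: "s > -1"
    and I: "((\<lambda>x. x powr (2 * s + 1) * (poly u x)\<^sup>2) has_integral I) {0<..<1}"
  shows "has_bochner_integral lborel (\<lambda>v. (cmod (mellin u (Complex s v)))\<^sup>2) (2 * pi * I)"
proof -
  let ?D = "{..degree u}" and ?c = "coeff u"
  define A where "A = (\<lambda>m. s + real (Suc m))"
  have A: "A m > 0" for m
    using s by (simp add: A_def)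
  have "((\<lambda>x. \<Sum>m\<in>?D. \<Sum>l\<in>?D. ?c m * ?c l * (x powr (2 * s + 1) * x ^ (m + l)))
      has_integral (\<Sum>m\<in>?D. \<Sum>l\<in>?D. ?c m * ?c l * (1 / (2 * s + 1 + real (m + l) + 1)))) {0<..<1}"
    using s by (intro has_integral_sum has_integral_mult_right has_integral_powr_mult_power) auto
  also have "(\<lambda>x. \<Sum>m\<in>?D. \<Sum>l\<in>?D. ?c m * ?c l * (x powr (2 * s + 1) * x ^ (m + l)))
      = (\<lambda>x. x powr (2 * s + 1) * (poly u x)\<^sup>2)"
    by (auto simp: poly_altdef power2_eq_square sum_product sum_distrib_left power_add mult_ac)
  finally have I_eq: "I = (\<Sum>m\<in>?D. \<Sum>l\<in>?D. ?c m * ?c l / (A m + A l))"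
    using has_integral_unique[OF I] by (simp add: A_def algebra_simps)
  have "has_bochner_integral lborel
      (\<lambda>v. \<Sum>m\<in>?D. \<Sum>l\<in>?D. ?c m * ?c l * ((A m / ((A m)\<^sup>2 + v\<^sup>2) + A l / ((A l)\<^sup>2 + v\<^sup>2)) / (A m + A l)))
      (\<Sum>m\<in>?D. \<Sum>l\<in>?D. ?c m * ?c l * ((pi + pi) / (A m + A l)))"
    by (intro has_bochner_integral_sum has_bochner_integral_mult_right
        has_bochner_integral_divide has_bochner_integral_add has_bochner_integral_Poisson A)
  also have "(\<Sum>m\<in>?D. \<Sum>l\<in>?D. ?c m * ?c l * ((pi + pi) / (A m + A l))) = 2 * pi * I"
    unfolding I_eq sum_distrib_left by (intro sum.cong refl) simp
  also have "(\<lambda>v. \<Sum>m\<in>?D. \<Sum>l\<in>?D. ?c m * ?c l * ((A m / ((A m)\<^sup>2 + v\<^sup>2) + A l / ((A l)\<^sup>2 + v\<^sup>2)) / (A m + A l)))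
      = (\<lambda>v. (cmod (mellin u (Complex s v)))\<^sup>2)"
  proof
    fix v
    have m: "mellin u (Complex s v) = (\<Sum>m\<in>?D. of_real (?c m) * (1 / Complex (A m) v))"
    proof -
      have "Complex s v + of_nat (Suc m) = Complex (A m) v" for m
        by (simp add: A_def complex_eq_iff)
      then show ?thesis
        by (simp add: mellin_def del: of_nat_Suc)
    qed
    have "(cmod (mellin u (Complex s v)))\<^sup>2 = Re (mellin u (Complex s v) * cnj (mellin u (Complex s v)))"
      by (simp only: cmod_power2 complex_mult_cnj Re_complex_of_real)
    also have "mellin u (Complex s v) * cnj (mellin u (Complex s v)) =
        (\<Sum>m\<in>?D. \<Sum>l\<in>?D. of_real (?c m * ?c l) * (1 / Complex (A m) v * cnj (1 / Complex (A l) v)))"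
      unfolding m cnj_sum sum_product by (intro sum.cong refl) (simp add: mult_ac)
    also have "Re \<dots> = (\<Sum>m\<in>?D. \<Sum>l\<in>?D. ?c m * ?c l * Re (1 / Complex (A m) v * cnj (1 / Complex (A l) v)))"
    proof -
      have "Re (complex_of_real c * w) = c * Re w" for c w
        by simp
      then show ?thesis
        by (simp only: Re_sum)
    qed
    finally show "(\<Sum>m\<in>?D. \<Sum>l\<in>?D. ?c m * ?c l * ((A m / ((A m)\<^sup>2 + v\<^sup>2) + A l / ((A l)\<^sup>2 + v\<^sup>2)) / (A m + A l)))
        = (cmod (mellin u (Complex s v)))\<^sup>2"
      by (simp only: Re_partial_fraction[OF A A])
  qed
  finally show ?thesis .
qed

section \<open>Durrmeyer polynomials of a moment sequence\<close>

text \<open>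
  The linear functional on polynomials that sends \<open>x ^ m\<close> to \<open>f m\<close>. It is what integration against
  the unknown density would be.
\<close>

definition moment :: "(nat \<Rightarrow> real) \<Rightarrow> real poly \<Rightarrow> real" where
  "moment f p = (\<Sum>m\<le>degree p. coeff p m * f m)"

lemma moment_eq_sum: "degree p \<le> N \<Longrightarrow> moment f p = (\<Sum>m\<le>N. coeff p m * f m)"
  unfolding moment_def by (intro sum.mono_neutral_left) (auto simp: coeff_eq_0)

lemma moment_add: "moment f (p + q) = moment f p + moment f q"
proof -
  let ?N = "max (degree p) (degree q)"
  have "degree (p + q) \<le> ?N"
    by (rule degree_add_le_max)
  then show ?thesis
    by (simp add: moment_eq_sum[of _ ?N] sum.distrib algebra_simps)
qed

lemma moment_smult: "moment f (smult c p) = c * moment f p"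
  by (simp add: moment_eq_sum[of _ "degree p"] degree_smult_le sum_distrib_left mult_ac)

lemma moment_0: "moment f 0 = 0"
  by (simp add: moment_def)

lemma moment_sum: "moment f (\<Sum>i\<in>A. p i) = (\<Sum>i\<in>A. moment f (p i))"
  by (induction A rule: infinite_finite_induct) (simp_all add: moment_0 moment_add)

lemma moment_monom: "moment f (monom c k) = c * f k"
proof -
  have "moment f (monom c k) = (\<Sum>m\<le>k. coeff (monom c k) m * f m)"
    by (intro moment_eq_sum degree_monom_le)
  also have "\<dots> = (\<Sum>m\<le>k. if m = k then c * f k else 0)"
    by (intro sum.cong) auto
  finally show ?thesis by simp
qed

text \<open>
  Multiplying by \<open>1 - x\<close> under the functional amounts to the negative forward difference of the
  sequence.
\<close>

lemma moment_difference:
  "moment f (monom 1 j * [:1, -1:] ^ i) = (-1) ^ i * (fdiff ^^ i) f j"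
proof (induction i arbitrary: j)
  case 0
  then show ?case by (simp add: moment_monom)
next
  case (Suc i)
  have "[:1, -1:] = (1 :: real poly) + smult (-1) (monom 1 1)"
    by (simp add: monom_altdef one_pCons)
  then have "([:1, -1:] :: real poly) ^ Suc i = (1 + smult (-1) (monom 1 1)) * [:1, -1:] ^ i"
    by (simp only: power_Suc)
  moreover have "A * ((1 + smult (-1) Y) * Q) = A * Q + smult (-1) ((A * Y) * Q)" for A Y Q :: "real poly"
    by (simp add: algebra_simps)
  ultimately have "monom 1 j * [:1, -1:] ^ Suc i
      = monom 1 j * [:1, -1:] ^ i + smult (-1) ((monom 1 j * monom 1 1) * [:1, -1:] ^ i :: real poly)"
    by (simp only:)
  also have "monom 1 j * monom 1 1 = (monom 1 (Suc j) :: real poly)"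
    by (simp add: mult_monom)
  finally show ?case
    by (simp only: moment_add moment_smult Suc) (simp add: fdiff_def algebra_simps)
qed

text \<open>
  The Bernstein basis, numbered by the exponent of \<open>1 - x\<close>, to agree with the order of the
  differences in \<open>hausdorff_condition\<close>.
\<close>

definition bernstein :: "nat \<Rightarrow> nat \<Rightarrow> real poly" where
  "bernstein n i = smult (of_nat (n choose i)) (monom 1 (n - i) * [:1, -1:] ^ i)"

lemma poly_bernstein: "poly (bernstein n i) x = of_nat (n choose i) * x ^ (n - i) * (1 - x) ^ i"
  by (simp add: bernstein_def poly_monom)

lemma bernstein_nonneg: "0 \<le> x \<Longrightarrow> x \<le> 1 \<Longrightarrow> poly (bernstein n i) x \<ge> 0"
  by (simp add: poly_bernstein)

lemma moment_bernstein:
  "moment f (bernstein n i) = of_nat (n choose i) * ((-1) ^ i * (fdiff ^^ i) f (n - i))"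
  by (simp add: bernstein_def moment_smult moment_difference)

text \<open>
  The factorial moments, up to \<open>fact l\<close>, of a binomial distribution with parameter \<open>x\<close>.
\<close>

lemma sum_choose_bernstein:
  "(\<Sum>i\<le>n. of_nat ((n - i) choose l) * poly (bernstein n i) x) = of_nat (n choose l) * x ^ l"
proof (cases "l \<le> n")
  case True
  have "(\<Sum>i\<le>n. of_nat ((n - i) choose l) * poly (bernstein n i) x)
      = (\<Sum>i\<le>n-l. of_nat ((n - i) choose l) * poly (bernstein n i) x)"
    using True by (intro sum.mono_neutral_right) auto
  also have "\<dots> = (\<Sum>i\<le>n-l. of_nat (n choose l) * x ^ l * (of_nat ((n - l) choose i) * (1 - x) ^ i * x ^ (n - l - i)))"
  proof (intro sum.cong refl)
    fix i assume i: "i \<in> {..n-l}"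
    have "(n choose i) * ((n - i) choose l) = (n choose (n - i)) * ((n - i) choose l)"
      using i by (simp add: binomial_symmetric[of i n])
    also have "\<dots> = (n choose l) * ((n - l) choose (n - i - l))"
      using i True by (intro choose_mult) auto
    also have "(n - l) choose (n - i - l) = (n - l) choose i"
      using i binomial_symmetric[of i "n - l"] by (simp add: diff_commute add.commute)
    finally have "real (n choose i) * real ((n - i) choose l) = real (n choose l) * real ((n - l) choose i)"
      by (simp flip: of_nat_mult)
    moreover have "x ^ (n - i) = x ^ l * x ^ (n - l - i)"
      using i True by (simp flip: power_add)
    ultimately show "of_nat ((n - i) choose l) * poly (bernstein n i) x
        = of_nat (n choose l) * x ^ l * (of_nat ((n - l) choose i) * (1 - x) ^ i * x ^ (n - l - i))"
      by (simp add: poly_bernstein mult_ac)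
  qed
  also have "\<dots> = of_nat (n choose l) * x ^ l"
    using binomial_ring[of "1 - x" x "n - l"] by (simp flip: sum_distrib_left)
  finally show ?thesis .
qed (auto simp: binomial_eq_0)

lemma sum_bernstein: "(\<Sum>i\<le>n. poly (bernstein n i) x) = 1"
  using sum_choose_bernstein[of n 0 x] by simp

text \<open>
  By Vandermonde's identity a rising factorial is a combination of falling factorials, and the
  expectation of a falling factorial under the binomial distribution is a monomial.
\<close>

lemma sum_rising_bernstein:
  "(\<Sum>i\<le>n. smult (of_nat ((n - i + k) choose k)) (bernstein n i))
     = (\<Sum>l\<le>k. monom (of_nat (k choose l) * of_nat (n choose l)) l)"
proof (rule poly_eq_poly_eq_iff[THEN iffD1], rule ext)
  fix x :: real
  have v: "(n - i + k) choose k = (\<Sum>l\<le>k. (k choose l) * ((n - i) choose l))" for i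
  proof -
    have "(k choose l) * ((n - i) choose l) = ((n - i) choose l) * (k choose (k - l))" if "l \<le> k" for l
      using binomial_symmetric[OF that] by simp
    then have "(\<Sum>l\<le>k. (k choose l) * ((n - i) choose l)) = (\<Sum>l\<le>k. ((n - i) choose l) * (k choose (k - l)))"
      by (intro sum.cong refl) simp
    then show ?thesis
      by (simp only: vandermonde)
  qed
  have "(\<Sum>i\<le>n. of_nat ((n - i + k) choose k) * poly (bernstein n i) x)
      = (\<Sum>l\<le>k. of_nat (k choose l) * (\<Sum>i\<le>n. of_nat ((n - i) choose l) * poly (bernstein n i) x))"
    unfolding v of_nat_sum of_nat_mult sum_distrib_right sum_distrib_left
    by (subst sum.swap) (simp add: mult_ac)
  also have "\<dots> = (\<Sum>l\<le>k. of_nat (k choose l) * (of_nat (n choose l) * x ^ l))"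
    by (simp only: sum_choose_bernstein)
  finally show "poly (\<Sum>i\<le>n. smult (of_nat ((n - i + k) choose k)) (bernstein n i)) x
      = poly (\<Sum>l\<le>k. monom (of_nat (k choose l) * of_nat (n choose l)) l) x"
    by (simp add: poly_sum poly_monom mult_ac)
qed

lemma has_integral_Beta_nat:
  "((\<lambda>x::real. x ^ a * (1 - x) ^ b) has_integral fact a * fact b / fact (a + b + 1)) {0<..<1}"
proof -
  have "((\<lambda>x::real. x powr (real (Suc a) - 1) * (1 - x) powr (real (Suc b) - 1)) has_integral
      Beta (real (Suc a)) (real (Suc b))) {0<..<1}"
    using has_integral_Beta_real[of "real (Suc a)" "real (Suc b)"]
    by (simp add: has_integral_Icc_iff_Ioo del: of_nat_Suc)
  moreover have "Beta (real (Suc a)) (real (Suc b)) = fact a * fact b / fact (a + b + 1)"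
    using Gamma_fact[of a, where 'a = real] Gamma_fact[of b, where 'a = real]
      Gamma_fact[of "a + b + 1", where 'a = real]
    by (simp add: Beta_def add_ac)
  moreover have "x powr (real (Suc a) - 1) * (1 - x) powr (real (Suc b) - 1) = x ^ a * (1 - x) ^ b"
    if "x \<in> {0<..<1}" for x :: real
    using that by (simp add: powr_realpow)
  ultimately show ?thesis
    by (subst has_integral_cong[symmetric]) auto
qed

lemma has_integral_power_bernstein:
  assumes "i \<le> n"
  shows "((\<lambda>x. x ^ k * poly (bernstein n i) x) has_integral
           of_nat ((n - i + k) choose k) / of_nat ((n + k + 1) choose k) / (real n + 1)) {0<..<1}"
proof -
  have "((\<lambda>x::real. of_nat (n choose i) * (x ^ (n - i + k) * (1 - x) ^ i)) has_integral
      of_nat (n choose i) * (fact (n - i + k) * fact i / fact ((n - i + k) + i + 1))) {0<..<1}"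
    by (intro has_integral_mult_right has_integral_Beta_nat)
  moreover have "(\<lambda>x. of_nat (n choose i) * (x ^ (n - i + k) * (1 - x) ^ i)) = (\<lambda>x. x ^ k * poly (bernstein n i) x)"
    by (simp add: poly_bernstein power_add mult_ac)
  moreover have "of_nat (n choose i) * (fact (n - i + k) * fact i / fact ((n - i + k) + i + 1))
      = (of_nat ((n - i + k) choose k) / of_nat ((n + k + 1) choose k) / (real n + 1) :: real)"
  proof -
    have idx: "(n - i + k) + i + 1 = n + k + 1"
      using assms by simp
    have c1: "real (n choose i) = fact n / (fact i * fact (n - i))"
      using assms by (rule binomial_fact)
    have c2: "real ((n - i + k) choose k) = fact (n - i + k) / (fact k * fact (n - i))"
      using binomial_fact[of k "n - i + k", where 'a = real] by simp
    have c3: "real ((n + k + 1) choose k) = fact (n + k + 1) / (fact k * ((real n + 1) * fact n))"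
      using binomial_fact[of k "n + k + 1", where 'a = real] by simp
    have "N / (J * D) * (X * J / F) = X / (Q * D) / (F / (Q * (r * N))) / r"
      if "N \<noteq> 0" "J \<noteq> 0" "D \<noteq> 0" "F \<noteq> 0" "Q \<noteq> 0" "r \<noteq> 0" for N J D X F Q r :: real
      using that by (simp add: field_simps)
    moreover have "real n + 1 \<noteq> 0"
      by linarith
    ultimately show ?thesis
      unfolding idx c1 c2 c3 using fact_nonzero by blast
  qed
  ultimately show ?thesis by simp
qed

text \<open>
  For \<open>f m = \<integral>\<^sub>0\<^sup>1 x ^ m * u x dx\<close> this is the Durrmeyer operator applied to \<open>u\<close>. Compared
  with step functions it has the advantage that its moments are an exact finite combination of
  \<open>f 0, ..., f k\<close>.
\<close>

definition durrmeyer :: "(nat \<Rightarrow> real) \<Rightarrow> nat \<Rightarrow> real poly" where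
  "durrmeyer f n = (\<Sum>i\<le>n. smult ((real n + 1) * moment f (bernstein n i)) (bernstein n i))"

text \<open>
  The operator is symmetric, so the \<open>k\<close>-th moment is the functional \<open>moment f\<close> at the
  Durrmeyer polynomial of \<open>x ^ k\<close>, a polynomial of degree at most \<open>k\<close>.
\<close>

lemma mellin_durrmeyer:
  "mellin (durrmeyer f n) (of_nat k) =
     of_real (\<Sum>l\<le>k. of_nat (k choose l) * (of_nat (n choose l) / of_nat ((n + k + 1) choose k)) * f l)"
proof -
  let ?C = "of_nat ((n + k + 1) choose k) :: real"
  let ?I = "\<Sum>i\<le>n. ((real n + 1) * moment f (bernstein n i)) * (of_nat ((n - i + k) choose k) / ?C / (real n + 1))"
  have "((\<lambda>x. \<Sum>i\<le>n. ((real n + 1) * moment f (bernstein n i)) * (x ^ k * poly (bernstein n i) x))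
      has_integral ?I) {0<..<1}"
    by (intro has_integral_sum has_integral_mult_right has_integral_power_bernstein) auto
  then have "((\<lambda>x. x ^ k * poly (durrmeyer f n) x) has_integral ?I) {0<..<1}"
    by (simp add: durrmeyer_def poly_sum sum_distrib_left mult_ac)
  then have "((\<lambda>x. complex_of_real (x ^ k * poly (durrmeyer f n) x)) has_integral of_real ?I) {0<..<1}"
    using has_integral_linear[OF _ bounded_linear_of_real, unfolded o_def] by blast
  moreover have "((\<lambda>x. complex_of_real (x ^ k * poly (durrmeyer f n) x)) has_integral
      mellin (durrmeyer f n) (of_nat k)) {0<..<1}"
    using mellin_has_integral[of "of_nat k" "durrmeyer f n"]
    by (rule has_integral_eq[rotated]) (auto simp: powr_nat')
  ultimately have "mellin (durrmeyer f n) (of_nat k) = of_real ?I"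
    by (intro has_integral_unique)
  also have "?I = moment f (\<Sum>i\<le>n. smult (of_nat ((n - i + k) choose k)) (bernstein n i)) / ?C"
  proof -
    have n: "real n + 1 \<noteq> 0"
      by linarith
    have "((real n + 1) * m) * (a / ?C / (real n + 1)) = a * m / ?C" for m a :: real
      using n by simp
    then show ?thesis
      by (simp only: moment_sum moment_smult sum_divide_distrib)
  qed
  also have "\<dots> = (\<Sum>l\<le>k. of_nat (k choose l) * (of_nat (n choose l) / ?C) * f l)"
    unfolding sum_rising_bernstein by (simp add: moment_sum moment_monom sum_divide_distrib)
  finally show ?thesis .
qed

text \<open>
  Numerator and denominator grow like \<open>n ^ l / fact l\<close> and \<open>n ^ k / fact k\<close>.
\<close>

lemma choose_quotient_limit:
  assumes "l \<le> k"
  shows "(\<lambda>n. real (n choose l) / real ((n + k + 1) choose k)) \<longlonglongrightarrow> (if l = k then 1 else 0)"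
proof -
  have lim: "(\<lambda>n. real (n choose l) / real n ^ l) \<longlonglongrightarrow> 1 / fact l" for l
  proof (rule LIMSEQ_offset)
    have 1: "(\<lambda>n. real ((l + n) choose n) / real (n ^ l)) \<longlonglongrightarrow> 1 / fact l"
      using fact_binomial_limit[of l, where 'a = real] .
    have 2: "(\<lambda>n. (real n / real (n + l)) ^ l) \<longlonglongrightarrow> 1 ^ l"
      by (intro tendsto_power) real_asymp
    have "(\<lambda>n. real ((l + n) choose n) / real (n ^ l) * (real n / real (n + l)) ^ l) \<longlonglongrightarrow> 1 / fact l"
      using tendsto_mult[OF 1 2] by simp
    moreover have "eventually (\<lambda>n. real ((l + n) choose n) / real (n ^ l) * (real n / real (n + l)) ^ l
        = real ((n + l) choose l) / real (n + l) ^ l) sequentially"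
      using eventually_gt_at_top[of 0]
    proof eventually_elim
      case (elim n)
      have "(l + n) choose n = (n + l) choose l"
        using binomial_symmetric[of n "l + n"] by (simp add: add.commute)
      then show ?case
        using elim by (simp add: power_divide)
    qed
    ultimately show "(\<lambda>n. real ((n + l) choose l) / real (n + l) ^ l) \<longlonglongrightarrow> 1 / fact l"
      using Lim_transform_eventually by fastforce
  qed
  have 1: "(\<lambda>n. real ((n + (k + 1)) choose k) / real (n + (k + 1)) ^ k) \<longlonglongrightarrow> 1 / fact k"
    using LIMSEQ_ignore_initial_segment[OF lim[of k], of "k + 1"] .
  have 2: "(\<lambda>n. (real n / real (n + (k + 1))) ^ l * (1 / real (n + (k + 1))) ^ (k - l)) \<longlonglongrightarrow> 1 ^ l * 0 ^ (k - l)"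
    by (intro tendsto_mult tendsto_power; real_asymp)
  have "(\<lambda>n. (real (n choose l) / real n ^ l) / (real ((n + (k + 1)) choose k) / real (n + (k + 1)) ^ k)
      * ((real n / real (n + (k + 1))) ^ l * (1 / real (n + (k + 1))) ^ (k - l)))
      \<longlonglongrightarrow> (1 / fact l) / (1 / fact k) * (1 ^ l * 0 ^ (k - l))" (is "?X \<longlonglongrightarrow> _")
    by (intro tendsto_mult tendsto_divide lim 1 2) auto
  moreover have "(1 / fact l) / (1 / fact k) * (1 ^ l * 0 ^ (k - l)) = (if l = k then 1 else 0 :: real)"
    using assms by auto
  moreover have "eventually (\<lambda>n. (real (n choose l) / real n ^ l) / (real ((n + (k + 1)) choose k) / real (n + (k + 1)) ^ k)
      * ((real n / real (n + (k + 1))) ^ l * (1 / real (n + (k + 1))) ^ (k - l))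
      = real (n choose l) / real ((n + k + 1) choose k)) sequentially"
    using eventually_gt_at_top[of 0]
  proof eventually_elim
    case (elim n)
    have "real (n + (k + 1)) ^ k = real (n + (k + 1)) ^ l * real (n + (k + 1)) ^ (k - l)"
      using assms by (simp flip: power_add)
    moreover have "real (n + (k + 1)) > 0" "real n > 0"
      using elim by auto
    ultimately show ?case
      by (simp add: power_divide add.assoc)
  qed
  ultimately show ?thesis
    using Lim_transform_eventually by fastforce
qed

lemma mellin_durrmeyer_limit: "(\<lambda>n. mellin (durrmeyer f n) (of_nat k)) \<longlonglongrightarrow> of_real (f k)"
proof -
  have "(\<lambda>n. \<Sum>l\<le>k. of_nat (k choose l) * (of_nat (n choose l) / of_nat ((n + k + 1) choose k)) * f l)
      \<longlonglongrightarrow> (\<Sum>l\<le>k. of_nat (k choose l) * (if l = k then 1 else 0) * f l)"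
    by (intro tendsto_sum tendsto_mult tendsto_const choose_quotient_limit) auto
  also have "(\<Sum>l\<le>k. of_nat (k choose l) * (if l = k then 1 else 0) * f l) = (\<Sum>l\<le>k. if l = k then f k else 0)"
    by (intro sum.cong) auto
  finally show ?thesis
    unfolding mellin_durrmeyer by (intro tendsto_of_real) simp
qed

text \<open>
  A form of Young's inequality that needs no norms: if \<open>\<bar>c\<bar> powr \<epsilon>\<close> is at least the weight, the first
  summand dominates; otherwise \<open>c\<close> is bounded by a power of \<open>x\<close>. The exponent of the weight is chosen
  such that this power becomes \<open>x powr (-1/2)\<close>, which is integrable.
\<close>

lemma weighted_square_le:
  fixes c x \<epsilon> :: real
  assumes x: "0 < x" "x < 1" and \<epsilon>: "\<epsilon> > 0"
  shows "x powr (- (\<epsilon> / (2 * (\<epsilon> + 2)))) * c\<^sup>2 \<le> \<bar>c\<bar> powr (2 + \<epsilon>) + x powr (-1/2)"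
proof -
  define s where "s = \<epsilon> / (2 * (\<epsilon> + 2))"
  have s: "- s + 2 * (- s / \<epsilon>) = -1/2"
  proof -
    have "- s + 2 * (- s / \<epsilon>) = - (s * (\<epsilon> + 2)) / \<epsilon>"
      using \<epsilon> by (simp add: field_simps)
    also have "s * (\<epsilon> + 2) = \<epsilon> / 2"
    proof -
      have "\<epsilon> + 2 \<noteq> 0"
        using \<epsilon> by linarith
      then show ?thesis
        by (simp only: s_def) (simp add: divide_simps)
    qed
    finally show ?thesis
      using \<epsilon> by simp
  qed
  have c2: "c\<^sup>2 = \<bar>c\<bar> powr 2"
    by simp
  show ?thesis
  proof (cases "x powr (-s) \<le> \<bar>c\<bar> powr \<epsilon>")
    case True
    then have "x powr (-s) * c\<^sup>2 \<le> \<bar>c\<bar> powr \<epsilon> * c\<^sup>2"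
      by (intro mult_right_mono) auto
    also have "\<dots> = \<bar>c\<bar> powr (2 + \<epsilon>)"
      unfolding c2 by (simp add: powr_add)
    finally show ?thesis
      by (simp add: s_def add_increasing2)
  next
    case False
    have "\<bar>c\<bar> = (\<bar>c\<bar> powr \<epsilon>) powr (1 / \<epsilon>)"
      using \<epsilon> by (simp add: powr_powr)
    also have "\<dots> \<le> (x powr (-s)) powr (1 / \<epsilon>)"
      using False \<epsilon> by (intro powr_mono2) auto
    finally have "\<bar>c\<bar> \<le> x powr (- s / \<epsilon>)"
      by (simp add: powr_powr)
    then have "\<bar>c\<bar> powr 2 \<le> (x powr (- s / \<epsilon>)) powr 2"
      by (intro powr_mono2) auto
    then have "x powr (-s) * c\<^sup>2 \<le> x powr (-s) * x powr (2 * (- s / \<epsilon>))"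
      unfolding c2 by (intro mult_left_mono) (auto simp: powr_powr mult_ac)
    also have "\<dots> = x powr (-1/2)"
      by (simp only: s flip: powr_add)
    finally show ?thesis
      by (simp add: s_def add_increasing)
  qed
qed

text \<open>
  Nonnegativity of the variance.
\<close>

lemma square_convex_combination:
  fixes b c :: "'a \<Rightarrow> real"
  assumes "finite A" "\<And>i. i \<in> A \<Longrightarrow> b i \<ge> 0" "(\<Sum>i\<in>A. b i) = 1"
  shows "(\<Sum>i\<in>A. c i * b i)\<^sup>2 \<le> (\<Sum>i\<in>A. (c i)\<^sup>2 * b i)"
proof -
  define \<mu> where "\<mu> = (\<Sum>i\<in>A. c i * b i)"
  have "0 \<le> (\<Sum>i\<in>A. (c i - \<mu>)\<^sup>2 * b i)"
    using assms by (intro sum_nonneg) auto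
  also have "\<dots> = (\<Sum>i\<in>A. (c i)\<^sup>2 * b i) - 2 * \<mu> * (\<Sum>i\<in>A. c i * b i) + \<mu>\<^sup>2 * (\<Sum>i\<in>A. b i)"
    by (simp add: power2_diff algebra_simps sum.distrib sum_subtractf sum_distrib_left sum_distrib_right)
  finally show ?thesis
    using assms(3) by (simp add: \<mu>_def[symmetric] power2_eq_square)
qed

text \<open>
  This is where the gain over \<open>L\<^sup>2\<close> is used. On the unit interval the polynomial is a convex
  combination of the numbers \<open>c i = (n + 1) * moment f (bernstein n i)\<close>. Bound its square by
  convexity, then each \<open>c i\<close> by the preceding inequality. Since each Bernstein polynomial has integral
  \<open>1 / (n + 1)\<close>, the sum that appears is the one in the Hausdorff condition.
\<close>

lemma durrmeyer_weighted_bound: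
  fixes f :: "nat \<Rightarrow> real"
  assumes \<epsilon>: "\<epsilon> > 0"
    and M: "(real n + 1) powr (1 + \<epsilon>) *
       (\<Sum>i\<le>n. real (n choose i) powr (2 + \<epsilon>) * \<bar>(fdiff ^^ i) f (n - i)\<bar> powr (2 + \<epsilon>)) \<le> M"
    and I: "((\<lambda>x. x powr (- (\<epsilon> / (2 * (\<epsilon> + 2)))) * (poly (durrmeyer f n) x)\<^sup>2) has_integral I) {0<..<1}"
  shows "I \<le> M + 2"
proof -
  let ?s = "\<epsilon> / (2 * (\<epsilon> + 2))"
  define c where "c = (\<lambda>i. (real n + 1) * moment f (bernstein n i))"
  have c: "\<bar>c i\<bar> powr (2 + \<epsilon>) = (real n + 1) powr (2 + \<epsilon>) *
      (real (n choose i) powr (2 + \<epsilon>) * \<bar>(fdiff ^^ i) f (n - i)\<bar> powr (2 + \<epsilon>))" for i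
    by (simp add: c_def moment_bernstein abs_mult powr_mult)
  have b: "((\<lambda>x. poly (bernstein n i) x) has_integral 1 / (real n + 1)) {0<..<1}" if "i \<le> n" for i
    using has_integral_power_bernstein[OF that, of 0] by simp
  have "((\<lambda>x. (\<Sum>i\<le>n. \<bar>c i\<bar> powr (2 + \<epsilon>) * poly (bernstein n i) x) + x powr (-1/2) * x ^ 0) has_integral
      (\<Sum>i\<le>n. \<bar>c i\<bar> powr (2 + \<epsilon>) * (1 / (real n + 1))) + 1 / (-1/2 + real 0 + 1)) {0<..<1}"
    by (intro has_integral_add has_integral_sum has_integral_mult_right b
        has_integral_powr_mult_power) auto
  then have "I \<le> (\<Sum>i\<le>n. \<bar>c i\<bar> powr (2 + \<epsilon>) * (1 / (real n + 1))) + 1 / (-1/2 + real 0 + 1)"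
  proof (rule has_integral_le[OF I])
    fix x :: real assume x: "x \<in> {0<..<1}"
    have "(poly (durrmeyer f n) x)\<^sup>2 \<le> (\<Sum>i\<le>n. (c i)\<^sup>2 * poly (bernstein n i) x)"
    proof -
      have "poly (durrmeyer f n) x = (\<Sum>i\<le>n. c i * poly (bernstein n i) x)"
        by (simp add: durrmeyer_def poly_sum c_def)
      then show ?thesis
        using x square_convex_combination[of "{..n}" "\<lambda>i. poly (bernstein n i) x" c]
        by (simp add: bernstein_nonneg sum_bernstein)
    qed
    then have "x powr (-?s) * (poly (durrmeyer f n) x)\<^sup>2
        \<le> x powr (-?s) * (\<Sum>i\<le>n. (c i)\<^sup>2 * poly (bernstein n i) x)"
      by (intro mult_left_mono) auto
    also have "\<dots> = (\<Sum>i\<le>n. (x powr (-?s) * (c i)\<^sup>2) * poly (bernstein n i) x)"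
      by (simp add: sum_distrib_left mult_ac)
    also have "\<dots> \<le> (\<Sum>i\<le>n. (\<bar>c i\<bar> powr (2 + \<epsilon>) + x powr (-1/2)) * poly (bernstein n i) x)"
      using x \<epsilon> by (intro sum_mono mult_right_mono weighted_square_le bernstein_nonneg) auto
    also have "\<dots> = (\<Sum>i\<le>n. \<bar>c i\<bar> powr (2 + \<epsilon>) * poly (bernstein n i) x) + x powr (-1/2) * x ^ 0"
      by (simp add: distrib_right sum.distrib sum_bernstein flip: sum_distrib_left)
    finally show "x powr (-?s) * (poly (durrmeyer f n) x)\<^sup>2
        \<le> (\<Sum>i\<le>n. \<bar>c i\<bar> powr (2 + \<epsilon>) * poly (bernstein n i) x) + x powr (-1/2) * x ^ 0" .
  qed
  also have "(\<Sum>i\<le>n. \<bar>c i\<bar> powr (2 + \<epsilon>) * (1 / (real n + 1))) = (real n + 1) powr (1 + \<epsilon>) *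
       (\<Sum>i\<le>n. real (n choose i) powr (2 + \<epsilon>) * \<bar>(fdiff ^^ i) f (n - i)\<bar> powr (2 + \<epsilon>))"
  proof -
    have "(real n + 1) powr (2 + \<epsilon>) = (real n + 1) powr (1 + \<epsilon>) * (real n + 1)"
      by (simp add: powr_add power2_eq_square)
    then show ?thesis
      by (simp add: c sum_distrib_left mult_ac)
  qed
  finally show ?thesis
    using M by simp
qed

lemma hausdorff_polynomials:
  assumes "hausdorff_condition f"
  obtains s K U where "0 < s" "s < 1"
    and "\<And>n I. ((\<lambda>x. x powr (-s) * (poly (U n) x)\<^sup>2) has_integral I) {0<..<1} \<Longrightarrow> I \<le> K"
    and "\<And>k. (\<lambda>n. mellin (U n) (of_nat k)) \<longlonglongrightarrow> of_real (f k)"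
proof -
  from assms obtain M \<epsilon> where M: "\<epsilon> > 0" "\<And>n. (real n + 1) powr (1 + \<epsilon>) *
       (\<Sum>i\<le>n. real (n choose i) powr (2 + \<epsilon>) * \<bar>(fdiff ^^ i) f (n - i)\<bar> powr (2 + \<epsilon>)) < M"
    unfolding hausdorff_condition_def by blast
  show thesis
  proof
    show "0 < \<epsilon> / (2 * (\<epsilon> + 2))" "\<epsilon> / (2 * (\<epsilon> + 2)) < 1"
      using M(1) by (simp_all add: field_simps)
    show "I \<le> M + 2" if "((\<lambda>x. x powr (- (\<epsilon> / (2 * (\<epsilon> + 2)))) * (poly (durrmeyer f n) x)\<^sup>2) has_integral I) {0<..<1}" for n I
      by (rule durrmeyer_weighted_bound[OF M(1) less_imp_le[OF M(2)] that])
    show "(\<lambda>n. mellin (durrmeyer f n) (of_nat k)) \<longlonglongrightarrow> of_real (f k)" for k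
      by (rule mellin_durrmeyer_limit)
  qed
qed

section \<open>Estimates under a weighted square norm\<close>

lemma has_integral_norm_le:
  fixes f :: "'a::euclidean_space \<Rightarrow> 'b::euclidean_space"
  assumes "(f has_integral i) S" "(g has_integral j) S" "\<And>x. x \<in> S \<Longrightarrow> norm (f x) \<le> g x"
  shows "norm i \<le> j"
  using integral_norm_bound_integral[of f S g] assms
  by (simp add: integral_unique has_integral_integrable)

text \<open>
  Finiteness of the norm that makes \<open>mellin u\<close> controllable to the left of \<open>Re z = -1/2\<close>.
\<close>

definition weighted_bound :: "real \<Rightarrow> real \<Rightarrow> real poly \<Rightarrow> bool" where
  "weighted_bound s K u \<longleftrightarrow> 0 < s \<and> s < 1 \<and>
     (\<exists>I\<le>K. ((\<lambda>x. x powr (-s) * (poly u x)\<^sup>2) has_integral I) {0<..<1})"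

lemma has_integral_powr_mult_poly_square:
  fixes r :: real and u :: "real poly"
  assumes "r > -1"
  obtains I where "((\<lambda>x. x powr r * (poly u x)\<^sup>2) has_integral I) {0<..<1}"
  using has_integral_powr_mult_poly[OF assms, of "u\<^sup>2"] by (auto simp: poly_power)

text \<open>
  The free parameter \<open>\<tau>\<close> replaces the optimisation in the Cauchy-Schwarz inequality.
\<close>

lemma powr_mult_le:
  fixes \<tau> x y :: real
  assumes "\<tau> > 0" "x > 0"
  shows "x powr \<sigma> * \<bar>y\<bar> \<le> (\<tau> * (x powr (-s) * y\<^sup>2) + (1 / \<tau>) * (x powr (2 * \<sigma> + s) * x ^ 0)) / 2"
proof -
  define P where "P = x powr (- s / 2) * \<bar>y\<bar>"
  define Q where "Q = x powr (\<sigma> + s / 2)"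
  have PQ: "P * Q = x powr \<sigma> * \<bar>y\<bar>"
    by (simp add: P_def Q_def mult_ac flip: powr_add)
  have "P\<^sup>2 = (x powr (- s / 2) * x powr (- s / 2)) * y\<^sup>2"
    by (simp add: P_def power2_eq_square)
  then have P2: "P\<^sup>2 = x powr (-s) * y\<^sup>2"
    by (simp flip: powr_add)
  have Q2: "Q\<^sup>2 = x powr (2 * \<sigma> + s)"
    by (simp add: Q_def power2_eq_square flip: powr_add)
  have "2 * \<tau> * (P * Q) \<le> \<tau>\<^sup>2 * P\<^sup>2 + Q\<^sup>2"
    using zero_le_power2[of "\<tau> * P - Q"] by (simp add: power2_diff power_mult_distrib)
  then have "P * Q \<le> (\<tau> * P\<^sup>2 + (1 / \<tau>) * Q\<^sup>2) / 2"
    using assms(1) by (simp add: field_simps power2_eq_square)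
  then show ?thesis
    by (simp add: PQ P2 Q2)
qed

text \<open>
  Taking \<open>\<tau>\<close> small and then \<open>Re z\<close> large shows that the transforms are small far to the right,
  uniformly over all \<open>u\<close> with the same \<open>s\<close> and \<open>K\<close>; \<open>\<tau> = 1\<close> gives local boundedness.
\<close>

lemma mellin_bound:
  assumes u: "weighted_bound s K u" and z: "2 * Re z + s + 1 > 0" and \<tau>: "\<tau> > 0"
  shows "cmod (mellin u z) \<le> (\<tau> * K + 1 / (\<tau> * (2 * Re z + s + 1))) / 2"
proof -
  obtain I where s: "0 < s" "s < 1" and IK: "I \<le> K"
    and I: "((\<lambda>x. x powr (-s) * (poly u x)\<^sup>2) has_integral I) {0<..<1}"
    using u by (auto simp: weighted_bound_def)
  have "((\<lambda>x. (\<tau> * (x powr (-s) * (poly u x)\<^sup>2) + (1 / \<tau>) * (x powr (2 * Re z + s) * x ^ 0)) / 2)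
      has_integral (\<tau> * I + (1 / \<tau>) * (1 / (2 * Re z + s + real 0 + 1))) / 2) {0<..<1}"
    using z by (intro has_integral_divide has_integral_add has_integral_mult_right I
        has_integral_powr_mult_power) auto
  moreover have "cmod (of_real x powr z * of_real (poly u x))
      \<le> (\<tau> * (x powr (-s) * (poly u x)\<^sup>2) + (1 / \<tau>) * (x powr (2 * Re z + s) * x ^ 0)) / 2"
    if "x \<in> {0<..<1}" for x
    using powr_mult_le[OF \<tau>, of x "Re z" "poly u x" s] that
    by (simp add: norm_mult norm_powr_real_powr)
  moreover have "Re z > -1"
    using z s by linarith
  ultimately have "cmod (mellin u z) \<le> (\<tau> * I + (1 / \<tau>) * (1 / (2 * Re z + s + real 0 + 1))) / 2"
    by (intro has_integral_norm_le[OF mellin_has_integral])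
  also have "\<dots> \<le> (\<tau> * K + 1 / (\<tau> * (2 * Re z + s + 1))) / 2"
    using IK \<tau> by simp
  finally show ?thesis .
qed

text \<open>
  On the unit interval \<open>x powr (2 * \<sigma> + 1) \<le> x powr (-s)\<close>, so Plancherel's identity bounds the
  norms on all lines in the half-plane by a single constant.
\<close>

lemma mellin_L2_bound:
  assumes u: "weighted_bound s K u" and \<sigma>: "2 * \<sigma> + s + 1 \<ge> 0"
  shows "(\<lambda>v. ennreal ((cmod (mellin u (Complex \<sigma> v)))\<^sup>2)) \<in> borel_measurable lborel"
    and "(\<integral>\<^sup>+v. ennreal ((cmod (mellin u (Complex \<sigma> v)))\<^sup>2) \<partial>lborel) \<le> ennreal (2 * pi * K)"
proof -
  obtain I where s: "0 < s" "s < 1" and IK: "I \<le> K"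
    and I: "((\<lambda>x. x powr (-s) * (poly u x)\<^sup>2) has_integral I) {0<..<1}"
    using u by (auto simp: weighted_bound_def)
  obtain J where J: "((\<lambda>x. x powr (2 * \<sigma> + 1) * (poly u x)\<^sup>2) has_integral J) {0<..<1}"
    using has_integral_powr_mult_poly_square[of "2 * \<sigma> + 1" u] \<sigma> s by auto
  have "J \<le> I"
    by (rule has_integral_le[OF J I]) (use \<sigma> in \<open>auto intro!: mult_right_mono powr_mono'\<close>)
  have B: "has_bochner_integral lborel (\<lambda>v. (cmod (mellin u (Complex \<sigma> v)))\<^sup>2) (2 * pi * J)"
    using \<sigma> s by (intro mellin_Plancherel J) linarith
  then have int: "integrable lborel (\<lambda>v. (cmod (mellin u (Complex \<sigma> v)))\<^sup>2)"
    by (rule integrable.intros)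
  then show "(\<lambda>v. ennreal ((cmod (mellin u (Complex \<sigma> v)))\<^sup>2)) \<in> borel_measurable lborel"
    by (intro measurable_compose[OF _ measurable_ennreal]) (rule borel_measurable_integrable)
  have "(\<integral>\<^sup>+v. ennreal ((cmod (mellin u (Complex \<sigma> v)))\<^sup>2) \<partial>lborel) = ennreal (2 * pi * J)"
    using nn_integral_eq_integral[OF int] B by (simp add: has_bochner_integral_integral_eq)
  also have "\<dots> \<le> ennreal (2 * pi * K)"
    using \<open>J \<le> I\<close> IK by (intro ennreal_leI mult_left_mono) auto
  finally show "(\<integral>\<^sup>+v. ennreal ((cmod (mellin u (Complex \<sigma> v)))\<^sup>2) \<partial>lborel) \<le> ennreal (2 * pi * K)" .
qed

text \<open>
  For \<open>0 < x < 1\<close> all terms \<open>(-1) ^ k * (x gchoose k)\<close> with \<open>k \<ge> 1\<close> are negative, so the sum of the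
  absolute values is an alternating sum, which has a closed form.
\<close>

lemma sum_abs_gbinomial_le:
  fixes x :: real
  assumes "0 < x" "x < 1"
  shows "(\<Sum>k\<le>n. \<bar>x gchoose k\<bar>) \<le> 2"
proof -
  have alt: "(-1) ^ k * (x gchoose k) = pochhammer (- x) k / fact k" for k and x :: real
    by (cases "even k") (simp_all add: gbinomial_pochhammer[of x])
  have nonneg: "pochhammer (1 - x) k / fact k \<ge> 0" for k
    using assms by (simp add: pochhammer_pos less_imp_le)
  have "\<bar>x gchoose k\<bar> = (if k = 0 then 2 else 0) - (x gchoose k) * (-1) ^ k" for k
  proof (cases k)
    case (Suc j)
    have "(-1) ^ k * (x gchoose k) = - (x * (pochhammer (1 - x) j / fact k))"
      by (simp only: alt Suc pochhammer_rec) simp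
    also have "\<dots> \<le> 0"
      using assms by (simp add: pochhammer_pos less_imp_le)
    finally have "(-1) ^ k * (x gchoose k) \<le> 0" .
    moreover have "\<bar>x gchoose k\<bar> = \<bar>(-1) ^ k * (x gchoose k)\<bar>"
      by (simp add: abs_mult)
    ultimately show ?thesis
      by (simp add: Suc mult.commute)
  qed simp
  then have "(\<Sum>k\<le>n. \<bar>x gchoose k\<bar>) = 2 - (\<Sum>k\<le>n. (x gchoose k) * (-1) ^ k)"
    by (simp add: sum_subtractf)
  also have "(\<Sum>k\<le>n. (x gchoose k) * (-1) ^ k) = (-1) ^ n * ((x - 1) gchoose n)"
    by (rule gbinomial_sum_lower_neg)
  also have "\<dots> = pochhammer (1 - x) n / fact n"
    by (simp add: alt)
  also have "2 - \<dots> \<le> 2"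
    using nonneg[of n] by simp
  finally show ?thesis .
qed

lemma summable_abs_gbinomial:
  fixes x :: real
  assumes "0 < x" "x < 1"
  shows "summable (\<lambda>k. \<bar>x gchoose k\<bar>)"
  by (rule bounded_imp_summable[of _ 2]) (use sum_abs_gbinomial_le[OF assms] in auto)

text \<open>
  The bound does not depend on \<open>t\<close>, although the binomial series has radius of convergence \<open>1\<close> and
  \<open>t\<close> may approach \<open>0\<close>. This uniformity allows integration of the series against \<open>u\<close>.
\<close>

lemma binomial_series_remainder:
  fixes x t :: real
  assumes x: "0 < x" "x < 1" and t: "0 < t" "t < 1"
  shows "\<bar>t powr x - (\<Sum>k<N. (x gchoose k) * (t - 1) ^ k)\<bar> \<le> (\<Sum>k. \<bar>x gchoose (k + N)\<bar>)"
proof -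
  have "(\<lambda>k. (x gchoose k) * (t - 1) ^ k) sums t powr x"
    using gen_binomial_real[of "t - 1" x] t by simp
  then have S: "(\<lambda>k. (x gchoose (k + N)) * (t - 1) ^ (k + N)) sums (t powr x - (\<Sum>k<N. (x gchoose k) * (t - 1) ^ k))"
    by (rule sums_split_initial_segment)
  have le: "\<bar>(x gchoose (k + N)) * (t - 1) ^ (k + N)\<bar> \<le> \<bar>x gchoose (k + N)\<bar>" for k
    using t by (simp add: abs_mult power_abs mult_left_le power_le_one)
  have sm: "summable (\<lambda>k. \<bar>x gchoose (k + N)\<bar>)"
    using summable_ignore_initial_segment[OF summable_abs_gbinomial[OF x], of N] by simp
  have sm': "summable (\<lambda>k. \<bar>(x gchoose (k + N)) * (t - 1) ^ (k + N)\<bar>)"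
    by (rule summable_comparison_test'[OF sm, of 0]) (use le in auto)
  have "\<bar>\<Sum>k. (x gchoose (k + N)) * (t - 1) ^ (k + N)\<bar> \<le> (\<Sum>k. \<bar>(x gchoose (k + N)) * (t - 1) ^ (k + N)\<bar>)"
    by (rule summable_rabs[OF sm'])
  also have "\<dots> \<le> (\<Sum>k. \<bar>x gchoose (k + N)\<bar>)"
    by (rule suminf_le[OF le sm' sm])
  finally show ?thesis
    using S by (simp add: sums_iff)
qed

text \<open>
  Forward differences of moments are integrals against powers of \<open>t - 1\<close>, hence the coefficients of
  the Newton series come from the binomial series of \<open>t powr x\<close>.
\<close>

lemma has_integral_fdiff:
  fixes \<mu> :: "nat \<Rightarrow> real"
  assumes "\<And>j. ((\<lambda>t. t ^ j * u t) has_integral \<mu> j) S"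
  shows "((\<lambda>t. t ^ j * (t - 1) ^ k * u t) has_integral (fdiff ^^ k) \<mu> j) S"
proof (induction k arbitrary: j)
  case (Suc k)
  have "((\<lambda>t. t ^ Suc j * (t - 1) ^ k * u t - t ^ j * (t - 1) ^ k * u t) has_integral
      (fdiff ^^ k) \<mu> (Suc j) - (fdiff ^^ k) \<mu> j) S"
    by (intro has_integral_diff Suc)
  then show ?case
    by (simp add: fdiff_def[of "(fdiff ^^ k) \<mu>"] algebra_simps)
qed (use assms in simp)

definition poly_moment :: "real poly \<Rightarrow> nat \<Rightarrow> real" where
  "poly_moment u j = Re (mellin u (of_nat j))"

lemma has_integral_poly_moment:
  "((\<lambda>t. t ^ j * poly u t) has_integral poly_moment u j) {0<..<1}"
proof -
  have "((\<lambda>x. Re (of_real x powr of_nat j * of_real (poly u x))) has_integral poly_moment u j) {0<..<1}"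
    unfolding poly_moment_def
    using has_integral_linear[OF mellin_has_integral[of "of_nat j" u] bounded_linear_Re] by (simp add: o_def)
  then show ?thesis
    by (rule has_integral_eq[rotated]) (auto simp: powr_nat' simp flip: of_real_power)
qed

text \<open>
  The integral of \<open>\<bar>poly u t\<bar>\<close> is at most \<open>(K + 1) / 2\<close>, so the remainder is uniform in \<open>u\<close>.
\<close>

lemma mellin_newton_remainder:
  assumes u: "weighted_bound s K u" and x: "0 < x" "x < 1"
  shows "cmod (mellin u (of_real x) - of_real (\<Sum>k<N. (x gchoose k) * (fdiff ^^ k) (poly_moment u) 0))
     \<le> (\<Sum>k. \<bar>x gchoose (k + N)\<bar>) * ((K + 1) / 2)"
proof -
  let ?R = "\<Sum>k. \<bar>x gchoose (k + N)\<bar>"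
  obtain I where s: "0 < s" "s < 1" and IK: "I \<le> K"
    and I: "((\<lambda>x. x powr (-s) * (poly u x)\<^sup>2) has_integral I) {0<..<1}"
    using u by (auto simp: weighted_bound_def)
  have R: "?R \<ge> 0"
    by (intro suminf_nonneg summable_ignore_initial_segment summable_abs_gbinomial x) auto
  have "((\<lambda>t. \<Sum>k<N. (x gchoose k) * (t ^ 0 * (t - 1) ^ k * poly u t)) has_integral
      (\<Sum>k<N. (x gchoose k) * (fdiff ^^ k) (poly_moment u) 0)) {0<..<1}"
    by (intro has_integral_sum has_integral_mult_right has_integral_fdiff has_integral_poly_moment) auto
  then have "((\<lambda>t. complex_of_real (\<Sum>k<N. (x gchoose k) * (t ^ 0 * (t - 1) ^ k * poly u t))) has_integral
      of_real (\<Sum>k<N. (x gchoose k) * (fdiff ^^ k) (poly_moment u) 0)) {0<..<1}"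
    using has_integral_linear[OF _ bounded_linear_of_real, unfolded o_def] by blast
  then have D: "((\<lambda>t. of_real t powr of_real x * of_real (poly u t)
        - complex_of_real (\<Sum>k<N. (x gchoose k) * (t ^ 0 * (t - 1) ^ k * poly u t))) has_integral
      mellin u (of_real x) - of_real (\<Sum>k<N. (x gchoose k) * (fdiff ^^ k) (poly_moment u) 0)) {0<..<1}"
    using x by (intro has_integral_diff mellin_has_integral) auto
  have B: "((\<lambda>t. ?R * ((1 * (t powr (-s) * (poly u t)\<^sup>2) + (1 / 1) * (t powr (2 * 0 + s) * t ^ 0)) / 2))
      has_integral ?R * ((1 * I + (1 / 1) * (1 / (2 * 0 + s + real 0 + 1))) / 2)) {0<..<1}"
    using s by (intro has_integral_mult_right has_integral_divide has_integral_add I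
        has_integral_powr_mult_power) auto
  have "cmod (mellin u (of_real x) - of_real (\<Sum>k<N. (x gchoose k) * (fdiff ^^ k) (poly_moment u) 0))
      \<le> ?R * ((1 * I + (1 / 1) * (1 / (2 * 0 + s + real 0 + 1))) / 2)"
  proof (rule has_integral_norm_le[OF D B])
    fix t :: real assume t: "t \<in> {0<..<1}"
    have "of_real t powr of_real x * of_real (poly u t)
        - complex_of_real (\<Sum>k<N. (x gchoose k) * (t ^ 0 * (t - 1) ^ k * poly u t))
        = of_real ((t powr x - (\<Sum>k<N. (x gchoose k) * (t - 1) ^ k)) * poly u t)"
    proof -
      have "(\<Sum>k<N. (x gchoose k) * (t ^ 0 * (t - 1) ^ k * poly u t)) = (\<Sum>k<N. (x gchoose k) * (t - 1) ^ k) * poly u t"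
        by (simp add: sum_distrib_left mult_ac)
      then show ?thesis
        using t by (simp only: powr_of_real) (simp add: powr_of_real left_diff_distrib)
    qed
    also have "cmod \<dots> = \<bar>t powr x - (\<Sum>k<N. (x gchoose k) * (t - 1) ^ k)\<bar> * (t powr 0 * \<bar>poly u t\<bar>)"
      using t by (simp only: norm_of_real abs_mult) simp
    also have "\<dots> \<le> ?R * ((1 * (t powr (-s) * (poly u t)\<^sup>2) + (1 / 1) * (t powr (2 * 0 + s) * t ^ 0)) / 2)"
      using t x R by (intro mult_mono binomial_series_remainder powr_mult_le) auto
    finally show "cmod (of_real t powr of_real x * of_real (poly u t)
        - complex_of_real (\<Sum>k<N. (x gchoose k) * (t ^ 0 * (t - 1) ^ k * poly u t)))
        \<le> ?R * ((1 * (t powr (-s) * (poly u t)\<^sup>2) + (1 / 1) * (t powr (2 * 0 + s) * t ^ 0)) / 2)" .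
  qed
  also have "\<dots> \<le> ?R * ((K + 1) / 2)"
    using IK s R by (intro mult_left_mono divide_right_mono add_mono) auto
  finally show ?thesis .
qed

section \<open>The interpolating function\<close>

lemma tendsto_fdiff:
  fixes \<mu> :: "nat \<Rightarrow> nat \<Rightarrow> real"
  assumes "\<And>j. (\<lambda>n. \<mu> n j) \<longlonglongrightarrow> f j"
  shows "(\<lambda>n. (fdiff ^^ k) (\<mu> n) j) \<longlonglongrightarrow> (fdiff ^^ k) f j"
proof (induction k arbitrary: j)
  case (Suc k)
  have "(\<lambda>n. (fdiff ^^ k) (\<mu> n) (Suc j) - (fdiff ^^ k) (\<mu> n) j) \<longlonglongrightarrow> (fdiff ^^ k) f (Suc j) - (fdiff ^^ k) f j"
    by (intro tendsto_diff Suc)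
  then show ?case
    by (simp add: fdiff_def[of "(fdiff ^^ k) _"])
qed (use assms in simp)

lemma compact_right_half_plane:
  assumes "compact K" "K \<subseteq> {z. Re z > c}"
  obtains d where "d > 0" "\<And>z. z \<in> K \<Longrightarrow> Re z \<ge> c + d"
proof (cases "K = {}")
  case False
  obtain w where w: "w \<in> K" "\<And>z. z \<in> K \<Longrightarrow> Re w \<le> Re z"
  proof -
    have "continuous_on K Re"
      by (intro continuous_intros)
    then show thesis
      using continuous_attains_inf[OF assms(1) False] that by blast
  qed
  show thesis
    using w assms(2) by (intro that[of "Re w - c"]) auto
qed (use that[of 1] in auto)

text \<open>
  All bounds on the transforms of the Durrmeyer polynomials are uniform in \<open>n\<close>, so that they pass to
  a locally uniform limit. A subsequence suffices, since the values at the natural numbers converge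
  along the full sequence.
\<close>

lemma hausdorff_interpolation:
  assumes "hausdorff_condition f"
  obtains c K C F where "c < -1/2" and "F holomorphic_on {z. Re z > c}"
    and "\<And>k. F (of_nat k) = of_real (f k)"
    and "\<And>\<sigma>. \<sigma> > c \<Longrightarrow> (\<integral>\<^sup>+v. ennreal ((cmod (F (Complex \<sigma> v)))\<^sup>2) \<partial>lborel) \<le> ennreal C"
    and "\<And>z \<tau>. Re z > c \<Longrightarrow> \<tau> > 0 \<Longrightarrow> cmod (F z) \<le> (\<tau> * K + 1 / (\<tau> * (2 * (Re z - c)))) / 2"
    and "\<And>x. 0 < x \<Longrightarrow> x < 1 \<Longrightarrow>
           (\<lambda>k. complex_of_real ((x gchoose k) * (fdiff ^^ k) f 0)) sums F (of_real x)"
proof -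
  obtain s K U where s: "0 < s" "s < 1"
    and UK: "\<And>n I. ((\<lambda>x. x powr (-s) * (poly (U n) x)\<^sup>2) has_integral I) {0<..<1} \<Longrightarrow> I \<le> K"
    and U_lim: "\<And>k. (\<lambda>n. mellin (U n) (of_nat k)) \<longlonglongrightarrow> of_real (f k)"
    by (rule hausdorff_polynomials[OF assms], rule that)
  have U: "weighted_bound s K (U n)" for n
  proof -
    have "- s > -1"
      using s by simp
    then obtain I where "((\<lambda>x. x powr (-s) * (poly (U n) x)\<^sup>2) has_integral I) {0<..<1}"
      by (rule has_integral_powr_mult_poly_square)
    then show ?thesis
      unfolding weighted_bound_def using s UK[of n I] by blast
  qed
  (* The abscissa at which \<open>2 * Re z + s + 1\<close> vanishes; it lies in (-1, -1/2), so the poles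
     of the transforms stay outside the half-plane. *)
  define c where "c = - (1 + s) / 2"
  define S where "S = {z. Re z > c}"
  have S: "open S"
    by (simp add: S_def open_halfspace_Re_gt)
  have S1: "S \<subseteq> {z. Re z > -1}"
    using s by (auto simp: S_def c_def)
  have U_bd: "cmod (mellin (U n) z) \<le> (\<tau> * K + 1 / (\<tau> * (2 * (Re z - c)))) / 2"
    if "Re z > c" "\<tau> > 0" for n z \<tau>
  proof -
    have eq: "2 * (Re z - c) = 2 * Re z + s + 1"
      by (simp add: c_def field_simps)
    have pos: "2 * Re z + s + 1 > 0"
      using that(1) by (simp add: c_def field_simps)
    show ?thesis
      unfolding eq by (rule mellin_bound[OF U pos that(2)])
  qed
  have loc_bd: "\<exists>B. \<forall>h\<in>range (\<lambda>n. mellin (U n)). \<forall>z\<in>X. cmod (h z) \<le> B" if X: "compact X" "X \<subseteq> S" for X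
  proof -
    obtain d where d: "d > 0" "\<And>z. z \<in> X \<Longrightarrow> Re z \<ge> c + d"
      by (rule compact_right_half_plane[OF X[unfolded S_def]], rule that)
    have "cmod (mellin (U n) z) \<le> (K + 1 / (2 * d)) / 2" if "z \<in> X" for n z
    proof -
      have "cmod (mellin (U n) z) \<le> (1 * K + 1 / (1 * (2 * (Re z - c)))) / 2"
        using d(1) d(2)[OF that] by (intro U_bd) simp_all
      also have "\<dots> \<le> (K + 1 / (2 * d)) / 2"
      proof -
        have "1 / (2 * (Re z - c)) \<le> 1 / (2 * d)"
          using d(1) d(2)[OF that] by (intro divide_left_mono) auto
        then show ?thesis by simp
      qed
      finally show ?thesis .
    qed
    then show ?thesis by blast
  qed
  obtain F r where F: "F holomorphic_on S" and r: "strict_mono (r :: nat \<Rightarrow> nat)"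
    and lim: "\<And>z. z \<in> S \<Longrightarrow> (\<lambda>n. mellin (U (r n)) z) \<longlonglongrightarrow> F z"
  proof (rule Montel[OF S, of "range (\<lambda>n. mellin (U n))" "\<lambda>n. mellin (U n)"])
    show "h holomorphic_on S" if "h \<in> range (\<lambda>n. mellin (U n))" for h
      using that holomorphic_on_subset[OF mellin_holomorphic S1] by auto
    show "\<exists>B. \<forall>h\<in>range (\<lambda>n. mellin (U n)). \<forall>z\<in>X. cmod (h z) \<le> B" if "compact X" "X \<subseteq> S" for X
      by (rule loc_bd[OF that])
  next
    fix g and r :: "nat \<Rightarrow> nat"
    assume "g holomorphic_on S" "strict_mono r" "\<And>z. z \<in> S \<Longrightarrow> (\<lambda>n. mellin (U (r n)) z) \<longlonglongrightarrow> g z"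
    then show thesis
      by (rule that)
  qed simp
  have c: "c < -1/2"
    using s by (simp add: c_def)
  have S_nat: "of_nat k \<in> S" for k
    using c by (auto simp: S_def)
  have F_nat: "F (of_nat k) = of_real (f k)" for k
    using LIMSEQ_unique[OF lim[OF S_nat] LIMSEQ_subseq_LIMSEQ[OF U_lim r, unfolded o_def]] .
  show thesis
  proof (rule that[OF c F[unfolded S_def] F_nat])
    show "cmod (F z) \<le> (\<tau> * K + 1 / (\<tau> * (2 * (Re z - c)))) / 2" if "Re z > c" "\<tau> > 0" for z \<tau>
    proof (rule tendsto_upperbound)
      show "(\<lambda>n. cmod (mellin (U (r n)) z)) \<longlonglongrightarrow> cmod (F z)"
        using that by (intro tendsto_norm lim) (simp add: S_def)
      show "\<forall>\<^sub>F n in sequentially. cmod (mellin (U (r n)) z) \<le> (\<tau> * K + 1 / (\<tau> * (2 * (Re z - c)))) / 2"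
        by (intro always_eventually allI U_bd that)
    qed simp
  next
    fix \<sigma> assume \<sigma>: "\<sigma> > c"
    then have \<sigma>': "2 * \<sigma> + s + 1 \<ge> 0"
      by (simp add: c_def field_simps)
    let ?u = "\<lambda>n v. ennreal ((cmod (mellin (U (r n)) (Complex \<sigma> v)))\<^sup>2)"
    have "liminf (\<lambda>n. ?u n v) = ennreal ((cmod (F (Complex \<sigma> v)))\<^sup>2)" for v
    proof -
      have "(\<lambda>n. ?u n v) \<longlonglongrightarrow> ennreal ((cmod (F (Complex \<sigma> v)))\<^sup>2)"
        using \<sigma> by (intro tendsto_ennrealI tendsto_power tendsto_norm lim) (simp add: S_def)
      then show ?thesis
        by (intro lim_imp_Liminf) auto
    qed
    then have "(\<integral>\<^sup>+v. ennreal ((cmod (F (Complex \<sigma> v)))\<^sup>2) \<partial>lborel) = (\<integral>\<^sup>+v. liminf (\<lambda>n. ?u n v) \<partial>lborel)"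
      by simp
    also have "\<dots> \<le> liminf (\<lambda>n. \<integral>\<^sup>+v. ?u n v \<partial>lborel)"
      by (intro nn_integral_liminf mellin_L2_bound(1)[OF U \<sigma>'])
    also have "\<dots> \<le> limsup (\<lambda>n. \<integral>\<^sup>+v. ?u n v \<partial>lborel)"
      by (intro Liminf_le_Limsup) simp
    also have "\<dots> \<le> ennreal (2 * pi * K)"
      by (intro Limsup_bounded always_eventually allI mellin_L2_bound(2)[OF U \<sigma>'])
    finally show "(\<integral>\<^sup>+v. ennreal ((cmod (F (Complex \<sigma> v)))\<^sup>2) \<partial>lborel) \<le> ennreal (2 * pi * K)" .
  next
    fix x :: real assume x: "0 < x" "x < 1"
    define R where "R = (\<lambda>N. (\<Sum>k. \<bar>x gchoose (k + N)\<bar>) * ((K + 1) / 2))"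
    have R: "R \<longlonglongrightarrow> 0 * ((K + 1) / 2)"
      unfolding R_def by (intro tendsto_mult tendsto_const suminf_exist_split2 summable_abs_gbinomial x)
    let ?P = "\<lambda>N. complex_of_real (\<Sum>k<N. (x gchoose k) * (fdiff ^^ k) f 0)"
    have "(\<lambda>n. poly_moment (U (r n)) j) \<longlonglongrightarrow> f j" for j
      using tendsto_Re[OF LIMSEQ_subseq_LIMSEQ[OF U_lim[of j] r]] by (simp add: poly_moment_def o_def)
    then have D: "(\<lambda>n. (fdiff ^^ k) (poly_moment (U (r n))) 0) \<longlonglongrightarrow> (fdiff ^^ k) f 0" for k
      by (rule tendsto_fdiff)
    have bdN: "cmod (F (of_real x) - ?P N) \<le> R N" for N
    proof (rule tendsto_upperbound)
      show "(\<lambda>n. cmod (mellin (U (r n)) (of_real x)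
          - of_real (\<Sum>k<N. (x gchoose k) * (fdiff ^^ k) (poly_moment (U (r n))) 0)))
          \<longlonglongrightarrow> cmod (F (of_real x) - ?P N)"
        using x c by (intro tendsto_norm tendsto_diff tendsto_of_real tendsto_sum tendsto_mult tendsto_const D lim)
          (simp add: S_def)
      show "\<forall>\<^sub>F n in sequentially. cmod (mellin (U (r n)) (of_real x)
          - of_real (\<Sum>k<N. (x gchoose k) * (fdiff ^^ k) (poly_moment (U (r n))) 0)) \<le> R N"
        unfolding R_def by (intro always_eventually allI mellin_newton_remainder[OF U x])
    qed simp
    have R0: "R \<longlonglongrightarrow> 0"
      using R by simp
    have "(\<lambda>N. F (of_real x) - ?P N) \<longlonglongrightarrow> 0"
      by (rule Lim_null_comparison[OF always_eventually R0]) (intro allI bdN)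
    then have "(\<lambda>N. F (of_real x) - (F (of_real x) - ?P N)) \<longlonglongrightarrow> F (of_real x) - 0"
      by (rule tendsto_diff[OF tendsto_const])
    then have "?P \<longlonglongrightarrow> F (of_real x)"
      by (simp only: diff_diff_eq2 add_diff_cancel_left' diff_zero)
    then show "(\<lambda>k. complex_of_real ((x gchoose k) * (fdiff ^^ k) f 0)) sums F (of_real x)"
      by (simp only: sums_def of_real_sum)
  qed
qed

section \<open>Decay at infinity\<close>

text \<open>
  A value of size \<open>e\<close> at \<open>v\<close> forces values of size \<open>e / 2\<close> on an interval of fixed length around \<open>v\<close>,
  hence a fixed amount of mass; the tails of the integral are eventually smaller than this.
\<close>

lemma integrable_Lipschitz_tendsto_0:
  fixes f :: "real \<Rightarrow> real"
  assumes int: "integrable lborel (\<lambda>v. (f v)\<^sup>2)"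
    and L: "L > 0" "\<And>v w. \<bar>f v - f w\<bar> \<le> L * \<bar>v - w\<bar>"
  shows "(f \<longlongrightarrow> 0) at_infinity"
proof (rule tendstoI)
  fix e :: real assume e: "e > 0"
  define \<rho> where "\<rho> = e / (2 * L)"
  have \<rho>: "\<rho> > 0"
    using e L by (simp add: \<rho>_def)
  define m where "m = (e / 2)\<^sup>2 * (2 * \<rho>)"
  have m: "m > 0"
    using e \<rho> by (simp add: m_def)
  let ?t = "\<lambda>n v. indicator {v. \<bar>v\<bar> \<ge> real n} v * (f v)\<^sup>2"
  have "(\<lambda>n. \<integral>v. ?t n v \<partial>lborel) \<longlonglongrightarrow> (\<integral>v. 0 \<partial>(lborel :: real measure))"
  proof (rule integral_dominated_convergence[where w = "\<lambda>v. (f v)\<^sup>2" and s = ?t])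
    show "AE v in lborel. (\<lambda>n. ?t n v) \<longlonglongrightarrow> 0"
    proof (intro AE_I2 tendsto_eventually)
      fix v :: real
      show "\<forall>\<^sub>F n in sequentially. ?t n v = 0"
        using eventually_gt_at_top[of "nat \<lceil>\<bar>v\<bar>\<rceil>"]
      proof eventually_elim
        case (elim n)
        then have "\<bar>v\<bar> < real n"
          using real_nat_ceiling_ge[of "\<bar>v\<bar>"] by linarith
        then show ?case by simp
      qed
    qed
    show "?t n \<in> borel_measurable lborel" for n
      using borel_measurable_integrable[OF int] by measurable
    show "AE v in lborel. norm (?t n v) \<le> (f v)\<^sup>2" for n
      by (auto simp: indicator_def)
  qed (use int in auto)
  then have "\<forall>\<^sub>F n in sequentially. (\<integral>v. ?t n v \<partial>lborel) < m"
    using m by (intro order_tendstoD) auto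
  then obtain n where n: "(\<integral>v. ?t n v \<partial>lborel) < m"
    using eventually_happens'[OF sequentially_bot] by auto
  have small: "\<bar>f v\<bar> < e" if v: "\<bar>v\<bar> \<ge> real n + \<rho>" for v
  proof (rule ccontr)
    assume "\<not> \<bar>f v\<bar> < e"
    have ge: "(e / 2)\<^sup>2 * indicator {v - \<rho>..v + \<rho>} w \<le> ?t n w" for w
    proof (cases "w \<in> {v - \<rho>..v + \<rho>}")
      case True
      then have vw: "\<bar>v - w\<bar> \<le> \<rho>"
        by auto
      have "\<bar>f v - f w\<bar> \<le> L * \<rho>"
        using L(2)[of v w] mult_left_mono[OF vw less_imp_le[OF L(1)]] by linarith
      also have "L * \<rho> = e / 2"
        using L by (simp add: \<rho>_def)
      finally have "e / 2 \<le> \<bar>f w\<bar>"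
        using \<open>\<not> \<bar>f v\<bar> < e\<close> by linarith
      then have "(e / 2)\<^sup>2 \<le> (f w)\<^sup>2"
        using e power_mono[of "e / 2" "\<bar>f w\<bar>" 2] by simp
      moreover have "\<bar>w\<bar> \<ge> real n"
        using vw v by linarith
      ultimately show ?thesis
        using True by simp
    qed simp
    have "m = (\<integral>w. (e / 2)\<^sup>2 * indicator {v - \<rho>..v + \<rho>} w \<partial>lborel)"
      using \<rho> by (simp add: m_def)
    also have "\<dots> \<le> (\<integral>w. ?t n w \<partial>lborel)"
    proof (rule integral_mono[OF _ _ ge])
      have "integrable lborel (\<lambda>w. indicator {v. \<bar>v\<bar> \<ge> real n} w *\<^sub>R (f w)\<^sup>2)"
        by (intro integrable_mult_indicator int) measurable
      then show "integrable lborel (?t n)"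
        by simp
    qed (use \<rho> in auto)
    finally show False
      using n by simp
  qed
  then show "\<forall>\<^sub>F v in at_infinity. dist (f v) 0 < e"
    unfolding eventually_at_infinity by (intro exI[of _ "real n + \<rho>"]) auto
qed

text \<open>
  Cauchy's estimate on discs of radius \<open>d / 2\<close>, which stay inside the domain.
\<close>

lemma bounded_holomorphic_Lipschitz:
  assumes F: "F holomorphic_on {z. Re z > c}" and d: "d > 0"
    and B: "\<And>z. Re z > c \<Longrightarrow> cmod (F z) \<le> B"
  obtains L where "L > 0"
    "\<And>z w. Re z \<ge> c + d \<Longrightarrow> Re w \<ge> c + d \<Longrightarrow> cmod (F z - F w) \<le> L * cmod (z - w)"
proof -
  let ?H = "{z. Re z \<ge> c + d}"
  have "cmod (F (of_real (c + d))) \<le> B"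
    using d by (intro B) simp
  then have B0: "B \<ge> 0"
    using norm_ge_zero order_trans by blast
  have op: "open {z. Re z > c}"
    by (rule open_halfspace_Re_gt)
  have der: "cmod (deriv F z) \<le> (B + 1) / (d / 2)" if "z \<in> ?H" for z
  proof -
    have sub: "cball z (d / 2) \<subseteq> {z. Re z > c}"
    proof
      fix w assume "w \<in> cball z (d / 2)"
      then have "\<bar>Re (z - w)\<bar> \<le> d / 2"
        using abs_Re_le_cmod[of "z - w"] by (simp add: dist_norm)
      then have "Re z - Re w \<le> d / 2"
        by (simp only: minus_complex.sel abs_le_iff)
      moreover have "c + d \<le> Re z"
        using that by simp
      ultimately have "c < Re w"
        using d by linarith
      then show "w \<in> {z. Re z > c}"
        by simp
    qed
    have "cmod ((deriv ^^ 1) F z) \<le> fact 1 * (B + 1) / (d / 2) ^ 1"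
    proof (rule Cauchy_higher_deriv_bound[of _ _ _ 0])
      show "F holomorphic_on ball z (d / 2)"
        by (rule holomorphic_on_subset[OF F order_trans[OF ball_subset_cball sub]])
      show "continuous_on (cball z (d / 2)) F"
        by (rule holomorphic_on_imp_continuous_on[OF holomorphic_on_subset[OF F sub]])
      show "F w \<in> ball 0 (B + 1)" if "w \<in> ball z (d / 2)" for w
      proof -
        have "Re w > c"
          using subsetD[OF sub, of w] that by simp
        then show ?thesis
          using B[of w] by simp
      qed
    qed (use d in auto)
    then show ?thesis by simp
  qed
  have "cmod (F z - F w) \<le> (B + 1) / (d / 2) * cmod (z - w)" if "z \<in> ?H" "w \<in> ?H" for z w
  proof (rule field_differentiable_bound[of ?H F "deriv F"])
    show "convex ?H"
      by (rule convex_halfspace_Re_ge)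
    show "(F has_field_derivative deriv F z) (at z within ?H)" if "z \<in> ?H" for z
      using that d by (intro holomorphic_derivI[OF F op]) simp
  qed (use der that in auto)
  then show thesis
    using d B0 by (intro that[of "(B + 1) / (d / 2)"]) auto
qed

text \<open>
  Far to the right the pointwise bound suffices. In the remaining vertical strip \<open>F\<close> tends to \<open>0\<close>
  on each line, and by the Lipschitz property finitely many lines control the whole strip.
\<close>

lemma half_plane_decay:
  assumes F: "F holomorphic_on {z. Re z > c}" and \<delta>: "\<delta> > c"
    and int: "\<And>\<sigma>. \<sigma> \<ge> \<delta> \<Longrightarrow> integrable lborel (\<lambda>v. (cmod (F (Complex \<sigma> v)))\<^sup>2)"
    and bd: "\<And>z \<tau>. Re z > c \<Longrightarrow> \<tau> > 0 \<Longrightarrow> cmod (F z) \<le> (\<tau> * K + 1 / (\<tau> * (2 * (Re z - c)))) / 2"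
  shows "(F \<longlongrightarrow> 0) (inf at_infinity (principal {z. Re z \<ge> \<delta>}))"
proof -
  define d where "d = (\<delta> - c) / 2"
  have d: "d > 0" "(c + d) + d = \<delta>"
    using \<delta> by (auto simp: d_def field_simps)
  have bd_d: "cmod (F z) \<le> (K + 1 / (2 * d)) / 2" if "Re z > c + d" for z
  proof -
    have "cmod (F z) \<le> (1 * K + 1 / (1 * (2 * (Re z - c)))) / 2"
      using d that by (intro bd) auto
    also have "1 / (1 * (2 * (Re z - c))) \<le> 1 / (2 * d)"
      using d that by (intro divide_left_mono) auto
    finally show ?thesis by simp
  qed
  have F': "F holomorphic_on {z. Re z > c + d}"
    using d by (intro holomorphic_on_subset[OF F]) auto
  obtain L where L: "L > 0"
    and Lip: "\<And>z w. Re z \<ge> \<delta> \<Longrightarrow> Re w \<ge> \<delta> \<Longrightarrow> cmod (F z - F w) \<le> L * cmod (z - w)"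
  proof (rule bounded_holomorphic_Lipschitz[where F = F and c = "c + d" and d = d, OF F' d(1) bd_d])
    fix L assume "L > 0" "\<And>z w. Re z \<ge> c + d + d \<Longrightarrow> Re w \<ge> c + d + d \<Longrightarrow> cmod (F z - F w) \<le> L * cmod (z - w)"
    then show thesis
      unfolding d(2) by (rule that)
  qed
  have line: "((\<lambda>v. cmod (F (Complex \<sigma> v))) \<longlongrightarrow> 0) at_infinity" if "\<sigma> \<ge> \<delta>" for \<sigma>
  proof (rule integrable_Lipschitz_tendsto_0[OF int[OF that] L])
    fix v w :: real
    have "\<bar>cmod (F (Complex \<sigma> v)) - cmod (F (Complex \<sigma> w))\<bar> \<le> cmod (F (Complex \<sigma> v) - F (Complex \<sigma> w))"
      by (rule norm_triangle_ineq3)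
    also have "\<dots> \<le> L * cmod (Complex \<sigma> v - Complex \<sigma> w)"
      using that by (intro Lip) auto
    also have "cmod (Complex \<sigma> v - Complex \<sigma> w) = \<bar>v - w\<bar>"
      by (simp add: cmod_def)
    finally show "\<bar>cmod (F (Complex \<sigma> v)) - cmod (F (Complex \<sigma> w))\<bar> \<le> L * \<bar>v - w\<bar>" .
  qed
  show ?thesis
  proof (rule tendstoI)
    fix e :: real assume e: "e > 0"
    (* The first summand of the pointwise bound is then at most e, the second one is small to the
       right of S. *)
    define \<tau> where "\<tau> = e / (\<bar>K\<bar> + 1)"
    have \<tau>: "\<tau> > 0" "\<tau> * K \<le> e"
    proof -
      have "\<bar>K\<bar> + 1 > 0"
        by linarith
      moreover have "e * K \<le> e * (\<bar>K\<bar> + 1)"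
        using e by (intro mult_left_mono) auto
      ultimately show "\<tau> > 0" "\<tau> * K \<le> e"
        using e by (simp_all add: \<tau>_def pos_divide_le_eq)
    qed
    define S where "S = max \<delta> (c + 1 / (\<tau> * e))"
    have right: "cmod (F z) < e" if "Re z > S" for z
    proof -
      have zc: "Re z - c > 1 / (\<tau> * e)" "Re z > c"
        using that \<delta> by (auto simp: S_def)
      then have "1 < (Re z - c) * (\<tau> * e)"
        using \<tau> e by (simp add: field_simps)
      then have "1 / (\<tau> * (2 * (Re z - c))) < e"
        using \<tau> e zc by (simp add: field_simps)
      then have "(\<tau> * K + 1 / (\<tau> * (2 * (Re z - c)))) / 2 < e"
        using \<tau>(2) by simp
      then show ?thesis
        using bd[OF zc(2) \<tau>(1)] by (rule le_less_trans[rotated])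
    qed
    define \<eta> where "\<eta> = e / (2 * L)"
    have \<eta>: "\<eta> > 0" "L * \<eta> = e / 2"
      using e L by (auto simp: \<eta>_def)
    (* The lines Re z = \<delta> + j * \<eta> with j \<le> J have distance \<eta>; moving to the nearest one on the left
       changes F by at most e / 2. *)
    define J where "J = nat \<lfloor>(S - \<delta>) / \<eta>\<rfloor>"
    have "\<forall>\<^sub>F v in at_infinity. \<forall>j\<in>{..J}. cmod (F (Complex (\<delta> + real j * \<eta>) v)) < e / 2"
      using \<eta> e by (intro eventually_ball_finite ballI order_tendstoD(2)[OF line]) simp_all
    then obtain T where "\<forall>v. T \<le> norm v \<longrightarrow> (\<forall>j\<in>{..J}. cmod (F (Complex (\<delta> + real j * \<eta>) v)) < e / 2)"
      unfolding eventually_at_infinity by (elim exE)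
    then have T: "cmod (F (Complex (\<delta> + real j * \<eta>) v)) < e / 2" if "\<bar>v\<bar> \<ge> T" "j \<le> J" for v j
      using that by simp
    have strip: "cmod (F z) < e" if z: "Re z \<ge> \<delta>" "Re z \<le> S" "\<bar>Im z\<bar> \<ge> T" for z
    proof -
      define j where "j = nat \<lfloor>(Re z - \<delta>) / \<eta>\<rfloor>"
      define w where "w = Complex (\<delta> + real j * \<eta>) (Im z)"
      have q: "(Re z - \<delta>) / \<eta> \<ge> 0"
        using z \<eta> by simp
      have jJ: "j \<le> J"
        unfolding j_def J_def using z \<eta> by (intro nat_mono floor_mono divide_right_mono) auto
      have "real j \<le> (Re z - \<delta>) / \<eta>" "(Re z - \<delta>) / \<eta> < real j + 1"
        using q by (auto simp: j_def)
      then have "\<bar>Re z - (\<delta> + real j * \<eta>)\<bar> \<le> \<eta>"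
        using \<eta> by (simp add: field_simps)
      moreover have "cmod (z - w) = \<bar>Re z - (\<delta> + real j * \<eta>)\<bar>"
        by (simp add: w_def cmod_def)
      moreover have "cmod (F z - F w) \<le> L * cmod (z - w)"
        using z \<eta> by (intro Lip) (auto simp: w_def)
      ultimately have "cmod (F z - F w) \<le> e / 2"
        using \<eta>(2) mult_left_mono[of "cmod (z - w)" \<eta> L] L by linarith
      moreover have "cmod (F w) < e / 2"
        using T[OF z(3) jJ] by (simp add: w_def)
      ultimately show ?thesis
        using norm_triangle_sub[of "F z" "F w"] by linarith
    qed
    have "dist (F z) 0 < e" if "cmod z \<ge> \<bar>S\<bar> + \<bar>\<delta>\<bar> + \<bar>T\<bar>" "Re z \<ge> \<delta>" for z
    proof (cases "Re z > S")
      case False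
      have "cmod z \<le> \<bar>Re z\<bar> + \<bar>Im z\<bar>"
        by (rule cmod_le)
      then have "\<bar>Im z\<bar> \<ge> T"
        using that False by linarith
      then show ?thesis
        using strip[OF that(2)] False by simp
    qed (use right in auto)
    then show "\<forall>\<^sub>F z in inf at_infinity (principal {z. Re z \<ge> \<delta>}). dist (F z) 0 < e"
      unfolding eventually_inf_principal eventually_at_infinity
      by (intro exI[of _ "\<bar>S\<bar> + \<bar>\<delta>\<bar> + \<bar>T\<bar>"]) simp
  qed
qed

section \<open>Uniqueness in the style of Carlson\<close>

text \<open>
  The Schwarz lemma, transported to the right half-plane by the Cayley transform that sends \<open>0\<close> to the
  zero \<open>k\<close>.
\<close>

lemma half_plane_Schwarz:
  assumes h: "h holomorphic_on {z. Re z > 0}"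
    and B: "\<And>z. Re z > 0 \<Longrightarrow> cmod (h z) \<le> B"
    and k: "k > 0" "h (of_real k) = 0" and z: "Re z > 0"
  shows "cmod (h z) \<le> B * (cmod (z - of_real k) / cmod (z + of_real k))"
proof -
  define \<phi> where "\<phi> = (\<lambda>w::complex. of_real k * (1 + w) / (1 - w))"
  define w where "w = (z - of_real k) / (z + of_real k)"
  have nz: "z + of_real k \<noteq> 0"
    using z k by (auto simp: complex_eq_iff)
  have \<phi>_pos: "Re (\<phi> w) > 0" if "cmod w < 1" for w
  proof -
    have "w \<noteq> 1"
      using that by auto
    then have "(cmod (1 - w))\<^sup>2 > 0"
      by simp
    moreover have "Re (\<phi> w) = k * (1 - (cmod w)\<^sup>2) / (cmod (1 - w))\<^sup>2"
      unfolding \<phi>_def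
      by (simp add: Re_divide cmod_power2) (simp add: algebra_simps power2_eq_square)
    moreover have "(cmod w)\<^sup>2 < 1"
      using that by (simp add: abs_square_less_1)
    ultimately show ?thesis
      using k by simp
  qed
  have \<phi>w: "\<phi> w = z"
  proof -
    have "1 + w = 2 * z / (z + of_real k)" "1 - w = 2 * of_real k / (z + of_real k)"
      using nz by (auto simp: w_def field_simps)
    then show ?thesis
      using nz k by (simp add: \<phi>_def)
  qed
  have w1: "cmod w < 1"
  proof -
    have "(cmod (z - of_real k))\<^sup>2 < (cmod (z + of_real k))\<^sup>2"
      unfolding cmod_power2 using z k by (simp add: power2_eq_square algebra_simps)
    then have "cmod (z - of_real k) < cmod (z + of_real k)"
      by (rule power_less_imp_less_base) simp
    then show ?thesis
      using nz by (simp add: w_def norm_divide)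
  qed
  have B0: "B \<ge> 0"
    using B[OF z] norm_ge_zero order_trans by blast
  (* The Schwarz lemma needs a strict bound; B' tends to B afterwards. *)
  have "cmod (h z) \<le> B' * cmod w" if B': "B' > B" for B'
  proof -
    let ?f = "\<lambda>w. h (\<phi> w) / of_real B'"
    have "cmod (?f w) \<le> cmod w"
    proof (rule Schwarz_Lemma(1)[OF _ _ _ w1])
      have "\<phi> holomorphic_on ball 0 1"
        unfolding \<phi>_def by (intro holomorphic_intros) auto
      then have "(h \<circ> \<phi>) holomorphic_on ball 0 1"
        by (rule holomorphic_on_compose_gen[OF _ h]) (use \<phi>_pos in auto)
      then show "?f holomorphic_on ball 0 1"
        using B' B0 by (auto intro!: holomorphic_intros simp: o_def)
      show "?f 0 = 0"
        using k by (simp add: \<phi>_def)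
      show "cmod (?f v) < 1" if "cmod v < 1" for v
        using B[OF \<phi>_pos[OF that]] B' B0 by (simp add: norm_divide)
    qed
    then show ?thesis
      using B' B0 by (simp add: norm_divide \<phi>w field_simps)
  qed
  then have "cmod (h z) \<le> (B + e) * cmod w" if "e > 0" for e
    using that by simp
  then have "cmod (h z) \<le> B * cmod w + e" if "e > 0" for e
  proof -
    have "cmod (h z) \<le> (B + e) * cmod w"
      using \<open>\<And>e. e > 0 \<Longrightarrow> cmod (h z) \<le> (B + e) * cmod w\<close> that by blast
    also have "\<dots> \<le> B * cmod w + e"
      using w1 that by (simp add: distrib_right mult_left_le)
    finally show ?thesis .
  qed
  then have "cmod (h z) \<le> B * cmod w"
    by (rule field_le_epsilon)
  then show ?thesis
    by (simp add: w_def norm_divide)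
qed

text \<open>
  Dividing by the Blaschke factor of a zero keeps the bound \<open>B\<close>, by the Schwarz lemma, so the zeros can
  be split off one after the other.
\<close>

lemma half_plane_Blaschke:
  assumes "h holomorphic_on {z. Re z > 0}"
    and "\<And>z. Re z > 0 \<Longrightarrow> cmod (h z) \<le> B"
    and "\<And>k. 1 \<le> k \<Longrightarrow> k \<le> N \<Longrightarrow> h (of_nat k) = 0" and "Re z > 0"
  shows "cmod (h z) \<le> B * (\<Prod>k=1..N. cmod (z - of_nat k) / cmod (z + of_nat k))"
  using assms
proof (induction N arbitrary: h z)
  case 0
  then show ?case by simp
next
  case (Suc N)
  define K :: complex where "K = of_nat (Suc N)"
  define P where "P = {z. Re z > 0}"
  have P: "open P" "K \<in> P"
    by (auto simp: P_def K_def open_halfspace_Re_gt)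
  have hK: "h K = 0"
    using Suc.prems(3)[of "Suc N"] by (simp add: K_def)
  have nz: "x + K \<noteq> 0" if "x \<in> P" for x
    using that by (auto simp: P_def K_def complex_eq_iff)
  have H: "(\<lambda>z. h z * (z + K)) holomorphic_on P"
    using Suc.prems(1) by (auto intro!: holomorphic_intros simp: P_def)
  define q where "q = (\<lambda>z. if z = K then deriv (\<lambda>z. h z * (z + K)) K else h z * (z + K) / (z - K))"
  have q: "q holomorphic_on P"
    by (rule pole_theorem_open_0[OF H P(1), of K]) (auto simp: q_def hK)
  have hq: "h x = q x * ((x - K) / (x + K))" if "x \<in> P" for x
    using nz[OF that] hK by (auto simp: q_def)
  have Bq': "cmod (q x) \<le> B" if "x \<in> P" "x \<noteq> K" for x
  proof -
    have "cmod (h x) \<le> B * (cmod (x - K) / cmod (x + K))"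
      using half_plane_Schwarz[OF Suc.prems(1,2), of "real (Suc N)" x] that hK
      by (simp add: K_def P_def)
    then show ?thesis
      using that nz[OF that(1)] by (simp add: hq[OF that(1)] norm_mult norm_divide divide_simps split: if_splits)
  qed
  have Bq: "cmod (q x) \<le> B" if "x \<in> P" for x
  proof (cases "x = K")
    case True
    have "isCont q K"
      using q P holomorphic_on_imp_continuous_on continuous_on_eq_continuous_at by blast
    then have "((\<lambda>x. cmod (q x)) \<longlongrightarrow> cmod (q K)) (at K)"
      by (intro tendsto_norm) (simp add: isCont_def)
    moreover have "eventually (\<lambda>x. cmod (q x) \<le> B) (at K)"
      using eventually_at_in_open[OF P] by eventually_elim (use Bq' in auto)
    ultimately show ?thesis
      using True by (intro tendsto_upperbound) auto
  qed (use Bq' that in auto)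
  have q0: "q (of_nat k) = 0" if "1 \<le> k" "k \<le> N" for k
  proof -
    have "of_nat k \<noteq> K"
      unfolding K_def of_nat_eq_iff using that by simp
    then show ?thesis
      using Suc.prems(3)[of k] that by (simp add: q_def)
  qed
  have "cmod (h z) = cmod (q z) * (cmod (z - K) / cmod (z + K))"
    using hq[of z] Suc.prems(4) by (simp add: P_def norm_mult norm_divide)
  also have "\<dots> \<le> (B * (\<Prod>k=1..N. cmod (z - of_nat k) / cmod (z + of_nat k))) * (cmod (z - K) / cmod (z + K))"
    using Suc.prems(4) q Bq q0 by (intro mult_right_mono Suc.IH) (auto simp: P_def)
  finally show ?case
    by (simp add: K_def)
qed

text \<open>
  At a real point \<open>x\<close> the \<open>k\<close>-th Blaschke factor is at most \<open>exp (- x / k)\<close>, so the divergence of the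
  harmonic series forces the value \<open>0\<close>.
\<close>

lemma bounded_vanishing_at_positive_integers:
  assumes h: "h holomorphic_on {z. Re z > 0}"
    and B: "\<And>z. Re z > 0 \<Longrightarrow> cmod (h z) \<le> B"
    and h0: "\<And>k::nat. k \<ge> 1 \<Longrightarrow> h (of_nat k) = 0" and z: "Re z > 0"
  shows "h z = 0"
proof -
  have real: "h (of_real x) = 0" if x: "0 < x" "x < 1" for x
  proof -
    have B0: "B \<ge> 0"
      using B[OF z] norm_ge_zero order_trans by blast
    have bd: "cmod (h (of_real x)) \<le> B * exp (- x * (harm N))" for N
    proof -
      have "cmod (h (of_real x)) \<le>
          B * (\<Prod>k=1..N. cmod (of_real x - of_nat k) / cmod (of_real x + of_nat k))"
        using assms x by (intro half_plane_Blaschke) auto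
      also have "\<dots> \<le> B * (\<Prod>k=1..N. exp (- x * inverse (real k)))"
      proof (intro mult_left_mono prod_mono conjI B0)
        fix k assume k: "k \<in> {1..N}"
        have "cmod (of_real x - of_nat k) = real k - x"
          using k x by (simp add: cmod_def)
        moreover have "cmod (of_real x + of_nat k) = real k + x"
          using k x by (simp add: cmod_def)
        ultimately have "cmod (of_real x - of_nat k) / cmod (of_real x + of_nat k) = 1 - 2 * x / (real k + x)"
          using k x by (simp add: field_simps)
        also have "\<dots> \<le> 1 - x / real k"
          using k x by (simp add: field_simps)
        also have "\<dots> \<le> exp (- x * inverse (real k))"
          using exp_ge_add_one_self[of "- x * inverse (real k)"] by (simp add: field_simps)
        finally show "cmod (of_real x - of_nat k) / cmod (of_real x + of_nat k)
            \<le> exp (- x * inverse (real k))" .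
      qed auto
      also have "(\<Prod>k=1..N. exp (- x * inverse (real k))) = exp (- x * harm N)"
        by (simp add: exp_sum[symmetric] harm_def sum_negf sum_distrib_left)
      finally show ?thesis .
    qed
    have "(\<lambda>N. B * exp (- x * harm N)) \<longlonglongrightarrow> B * 0"
    proof (intro tendsto_mult tendsto_const filterlim_compose[OF exp_at_bot])
      show "filterlim (\<lambda>N. - x * harm N) at_bot sequentially"
        using x harm_at_top by (intro filterlim_tendsto_neg_mult_at_bot[of _ "-x"]) auto
    qed
    then have "cmod (h (of_real x)) \<le> B * 0"
      by (rule tendsto_lowerbound) (use bd in auto)
    then show ?thesis by simp
  qed
  have conn: "connected {z. Re z > (0::real)}"
    by (intro convex_connected convex_halfspace_Re_gt)
  have lim: "of_real (1/2) islimpt (of_real ` {0<..<1::real} :: complex set)"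
  proof -
    have "(1/2::real) islimpt {0<..<1}"
      by (simp add: islimpt_greaterThanLessThan1 interior_limit_point)
    then show ?thesis
      unfolding islimpt_approachable
      by (metis (no_types, lifting) dist_of_real image_eqI of_real_eq_iff)
  qed
  show ?thesis
  proof (rule analytic_continuation[OF h _ conn _ _ lim])
    show "of_real ` {0<..<1} \<subseteq> {z. Re z > 0}"
      by auto
  qed (use real z in \<open>auto simp: open_halfspace_Re_gt\<close>)
qed

section \<open>Integrability on lines and division by a power\<close>

text \<open>
  If \<open>p > 0\<close>, convergence of the quotient forces \<open>F 0 = 0\<close>, so that one factor \<open>z\<close> can be removed
  and the exponent decreases. In this way a limit along the positive reals alone determines the order
  of vanishing.
\<close>

lemma divide_power_holomorphic:
  assumes "open S" "0 \<in> S" "F holomorphic_on S"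
    and "((\<lambda>x. F (of_real x) / of_real x ^ p) \<longlongrightarrow> L) (at_right 0)"
  shows "\<exists>G. G holomorphic_on S \<and> (\<forall>z\<in>S. F z = z ^ p * G z) \<and> G 0 = L"
  using assms(3,4)
proof (induction p arbitrary: F)
  case 0
  have "isCont F 0"
    using 0 assms(1,2) holomorphic_on_imp_continuous_on continuous_on_eq_continuous_at by blast
  then have "((\<lambda>x::real. F (of_real x)) \<longlongrightarrow> F (of_real 0)) (at_right 0)"
    by (intro isCont_tendsto_compose[of _ F] tendsto_intros) simp_all
  then have "F 0 = L"
    using tendsto_unique[OF trivial_limit_at_right_real] 0 by fastforce
  then show ?case
    using 0 by auto
next
  case (Suc p)
  have cont: "isCont F 0"
    using Suc.prems assms(1,2) holomorphic_on_imp_continuous_on continuous_on_eq_continuous_at by blast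
  have id: "((\<lambda>x::real. complex_of_real x) \<longlongrightarrow> of_real 0) (at_right 0)"
    by (intro tendsto_intros)
  have "((\<lambda>x. of_real x ^ Suc p * (F (of_real x) / of_real x ^ Suc p)) \<longlongrightarrow> of_real 0 ^ Suc p * L) (at_right 0)"
    by (rule tendsto_mult[OF tendsto_power[OF id] Suc.prems(2)])
  moreover have "\<forall>\<^sub>F x::real in at_right 0. of_real x ^ Suc p * (F (of_real x) / of_real x ^ Suc p) = F (of_real x)"
    using eventually_at_right_less[of 0] by eventually_elim simp
  ultimately have "((\<lambda>x::real. F (of_real x)) \<longlongrightarrow> of_real 0 ^ Suc p * L) (at_right 0)"
    by (rule Lim_transform_eventually)
  moreover have "((\<lambda>x::real. F (of_real x)) \<longlongrightarrow> F (of_real 0)) (at_right 0)"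
    using cont by (intro isCont_tendsto_compose[OF _ id]) simp
  ultimately have F0: "F 0 = 0"
    using tendsto_unique[OF trivial_limit_at_right_real] by fastforce
  define G where "G = (\<lambda>z. if z = 0 then deriv F 0 else F z / z)"
  have G: "G holomorphic_on S"
    by (rule pole_theorem_open_0[OF Suc.prems(1) assms(1), of 0]) (auto simp: G_def F0)
  have FG: "F z = z * G z" for z
    by (simp add: G_def F0)
  have "\<forall>\<^sub>F x::real in at_right 0. F (of_real x) / of_real x ^ Suc p = G (of_real x) / of_real x ^ p"
    using eventually_at_right_less[of 0] by eventually_elim (simp add: FG)
  then have "((\<lambda>x. G (of_real x) / of_real x ^ p) \<longlongrightarrow> L) (at_right 0)"
    by (rule Lim_transform_eventually[OF Suc.prems(2)])
  then obtain G' where "G' holomorphic_on S" "\<forall>z\<in>S. G z = z ^ p * G' z" "G' 0 = L"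
    using Suc.IH[OF G] by blast
  then show ?case
    using FG by (intro exI[of _ G']) (simp add: mult.assoc)
qed

lemma integrable_line_L2:
  assumes F: "F holomorphic_on {z. Re z > c}" and \<sigma>: "\<sigma> > c"
    and bd: "(\<integral>\<^sup>+v. ennreal ((cmod (F (Complex \<sigma> v)))\<^sup>2) \<partial>lborel) \<le> ennreal C"
  shows "integrable lborel (\<lambda>v. (cmod (F (Complex \<sigma> v)))\<^sup>2)"
proof (rule integrableI_bounded)
  have "continuous_on UNIV (\<lambda>v. (cmod (F (Complex \<sigma> v)))\<^sup>2)"
  proof (intro continuous_on_power continuous_on_norm continuous_on_compose2[OF holomorphic_on_imp_continuous_on[OF F]])
    show "continuous_on UNIV (Complex \<sigma>)"
      by (simp add: Complex_eq continuous_intros)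
  qed (use \<sigma> in auto)
  then show "(\<lambda>v. (cmod (F (Complex \<sigma> v)))\<^sup>2) \<in> borel_measurable lborel"
    using borel_measurable_continuous_onI by simp
  show "(\<integral>\<^sup>+v. ennreal (norm ((cmod (F (Complex \<sigma> v)))\<^sup>2)) \<partial>lborel) < \<infinity>"
    using bd by (simp add: le_less_trans[OF _ ennreal_less_top])
qed

lemma integrable_inverse_1_plus_square_lborel: "integrable lborel (\<lambda>v::real. 1 / (1 + v\<^sup>2))"
  using has_bochner_integral_Poisson[of 1] by (auto simp: has_bochner_integral_iff)

text \<open>
  Near \<open>v = 0\<close> the quotient is bounded, because \<open>F\<close> vanishes at \<open>0\<close>; elsewhere
  \<open>2 * (\<bar>F\<bar> / \<bar>v\<bar>) \<le> \<bar>F\<bar>\<^sup>2 + 1 / v\<^sup>2\<close>. The function \<open>G\<close> agrees with the holomorphic extension of the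
  quotient up to the value at one point, a null set on the line.
\<close>

lemma integrable_line_L1:
  assumes F: "F holomorphic_on {z. Re z > c}" and c: "c < \<sigma>" "c < 0" and F0: "F 0 = 0"
    and int: "integrable lborel (\<lambda>v. (cmod (F (Complex \<sigma> v)))\<^sup>2)"
    and G: "\<And>z. z \<noteq> 0 \<Longrightarrow> G z = F z / z"
  shows "integrable lborel (\<lambda>v. G (Complex \<sigma> v))"
proof -
  define H where "H = (\<lambda>z. if z = 0 then deriv F 0 else F z / z)"
  have H: "H holomorphic_on {z. Re z > c}"
    by (rule pole_theorem_open_0[OF F open_halfspace_Re_gt, of 0]) (auto simp: H_def F0)
  have contH: "continuous_on A (\<lambda>v. H (Complex \<sigma> v))" for A
  proof (intro continuous_on_compose2[OF holomorphic_on_imp_continuous_on[OF H]])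
    show "continuous_on A (Complex \<sigma>)"
      by (simp add: Complex_eq continuous_intros)
  qed (use c in auto)
  have "compact ((\<lambda>v. H (Complex \<sigma> v)) ` {-1..1})"
    by (intro compact_continuous_image contH) simp
  then obtain B where "\<forall>x\<in>(\<lambda>v. H (Complex \<sigma> v)) ` {-1..1}. cmod x \<le> B"
    using compact_imp_bounded bounded_iff by blast
  then have B: "cmod (H (Complex \<sigma> v)) \<le> B" if "\<bar>v\<bar> \<le> 1" for v
    using that by (simp add: abs_le_iff)
  have B0: "B \<ge> 0"
    using order_trans[OF norm_ge_zero B[of 0]] by simp
  have "integrable lborel (\<lambda>v. H (Complex \<sigma> v))"
  proof (rule Bochner_Integration.integrable_bound)
    show "integrable lborel (\<lambda>v. (cmod (F (Complex \<sigma> v)))\<^sup>2 + (2 * B + 1) * (1 / (1 + v\<^sup>2)))"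
      by (intro Bochner_Integration.integrable_add int integrable_mult_right
          integrable_inverse_1_plus_square_lborel)
    show "(\<lambda>v. H (Complex \<sigma> v)) \<in> borel_measurable lborel"
      using borel_measurable_continuous_onI[OF contH] by simp
    have "cmod (H (Complex \<sigma> v)) \<le> (cmod (F (Complex \<sigma> v)))\<^sup>2 + (2 * B + 1) * (1 / (1 + v\<^sup>2))" for v
    proof (cases "\<bar>v\<bar> \<le> 1")
      case True
      then have "v\<^sup>2 \<le> 1"
        by (simp add: abs_square_le_1)
      then have "1 / (1 + v\<^sup>2) \<ge> 1 / 2"
        by (intro divide_left_mono) (auto intro: add_pos_nonneg)
      have "cmod (H (Complex \<sigma> v)) \<le> (2 * B + 1) * (1 / 2)"
        using B[OF True] by simp
      also have "\<dots> \<le> (2 * B + 1) * (1 / (1 + v\<^sup>2))"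
        using \<open>1 / (1 + v\<^sup>2) \<ge> 1 / 2\<close> B0 by (intro mult_left_mono) auto
      also have "\<dots> \<le> (cmod (F (Complex \<sigma> v)))\<^sup>2 + (2 * B + 1) * (1 / (1 + v\<^sup>2))"
        by simp
      finally show ?thesis .
    next
      case False
      let ?z = "Complex \<sigma> v" and ?x = "cmod (F (Complex \<sigma> v))"
      have v1: "v\<^sup>2 > 1"
        using False by (simp add: abs_square_le_1 not_le[symmetric])
      have "?z \<noteq> 0"
        using False by (auto simp: complex_eq_iff)
      have zv: "cmod ?z \<ge> \<bar>v\<bar>"
        using abs_Im_le_cmod[of ?z] by simp
      have "cmod (H ?z) = ?x / cmod ?z"
        using \<open>?z \<noteq> 0\<close> by (simp add: H_def norm_divide)
      also have "\<dots> \<le> ?x / \<bar>v\<bar>"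
        using zv False \<open>?z \<noteq> 0\<close> by (intro divide_left_mono mult_pos_pos) auto
      also have "\<dots> = ?x * (1 / \<bar>v\<bar>)"
        by simp
      also have "\<dots> \<le> (?x\<^sup>2 + (1 / \<bar>v\<bar>)\<^sup>2) / 2"
        using sum_squares_bound[of ?x "1 / \<bar>v\<bar>"] by (simp add: mult.commute)
      also have "\<dots> = ?x\<^sup>2 / 2 + 1 / (2 * v\<^sup>2)"
        by (simp add: power_divide add_divide_distrib)
      also have "\<dots> \<le> ?x\<^sup>2 + 1 / (1 + v\<^sup>2)"
      proof (rule add_mono)
        have "1 / (2 * q) \<le> 1 / (1 + q)" if "q > 1" for q :: real
          using that by (simp add: field_simps)
        then show "1 / (2 * v\<^sup>2) \<le> 1 / (1 + v\<^sup>2)"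
          using v1 by blast
      qed simp
      also have "\<dots> \<le> ?x\<^sup>2 + (2 * B + 1) * (1 / (1 + v\<^sup>2))"
        using mult_right_mono[of 1 "2 * B + 1" "1 / (1 + v\<^sup>2)"] B0 by simp
      finally show ?thesis .
    qed
    then show "AE v in lborel. norm (H (Complex \<sigma> v)) \<le> norm ((cmod (F (Complex \<sigma> v)))\<^sup>2 + (2 * B + 1) * (1 / (1 + v\<^sup>2)))"
      unfolding real_norm_def by (intro AE_I2 order_trans[OF _ abs_ge_self])
  qed
  also have "?this \<longleftrightarrow> ?thesis"
    by (rule integrable_discrete_difference[of "{0}"]) (auto simp: H_def G complex_eq_iff)
  finally show ?thesis .
qed

text \<open>
  The decay at infinity bounds the function outside a compact set, continuity inside.
\<close>

lemma regular_interpolation_bounded: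
  assumes "regular_interpolation p a E h"
  obtains B where "\<And>z. Re z > 0 \<Longrightarrow> cmod (z ^ p * h z) \<le> B"
proof -
  let ?F = "\<lambda>z. z ^ p * h z"
  have F: "?F holomorphic_on {z. Re z > -1/2}"
    using assms by (simp add: regular_interpolation_def carlsonian_interpolation_def hardy2_def)
  have "(?F \<longlongrightarrow> 0) (inf at_infinity (principal {z. Re z \<ge> 0}))"
    using assms by (simp add: regular_interpolation_def)
  then have "\<forall>\<^sub>F z in inf at_infinity (principal {z. Re z \<ge> 0}). dist (?F z) 0 < 1"
    by (rule tendstoD) simp
  then obtain b where b: "\<forall>z. b \<le> norm z \<longrightarrow> z \<in> {z. Re z \<ge> 0} \<longrightarrow> dist (?F z) 0 < 1"
    unfolding eventually_inf_principal eventually_at_infinity by (elim exE)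
  have "compact ({z. Re z \<ge> 0} \<inter> cball 0 b)"
    by (intro closed_Int_compact closed_halfspace_Re_ge) simp
  then have "compact (?F ` ({z. Re z \<ge> 0} \<inter> cball 0 b))"
    by (rule compact_continuous_image[rotated])
       (rule continuous_on_subset[OF holomorphic_on_imp_continuous_on[OF F]], auto)
  then obtain B where B: "\<forall>x\<in>?F ` ({z. Re z \<ge> 0} \<inter> cball 0 b). cmod x \<le> B"
    using compact_imp_bounded bounded_iff by blast
  show thesis
  proof (rule that)
    fix z :: complex assume z: "Re z > 0"
    show "cmod (?F z) \<le> max 1 B"
    proof (cases "b \<le> norm z")
      case True
      then have "cmod (?F z) < 1"
        using b z by simp
      then show ?thesis by simp
    next
      case False
      then have "cmod (?F z) \<le> B"
        using z by (intro B[rule_format] imageI) simp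
      then show ?thesis by simp
    qed
  qed
qed

text \<open>
  The difference vanishes on \<open>Re z > 0\<close> by the Blaschke argument, on \<open>Re z > -1/2\<close> by analytic
  continuation, and on the boundary by continuity. At \<open>0\<close>, where \<open>z ^ p\<close> gives no information, both
  functions have the value \<open>a 0\<close>.
\<close>

lemma regular_interpolation_unique:
  assumes p: "p \<ge> 1"
    and h: "regular_interpolation p a {0} h" and g: "regular_interpolation p a {0} g"
    and z: "Re z \<ge> -1/2"
  shows "h z = g z"
proof -
  define D where "D = (\<lambda>z. z ^ p * h z - z ^ p * g z)"
  obtain B1 where B1: "\<And>z. Re z > 0 \<Longrightarrow> cmod (z ^ p * h z) \<le> B1"
    by (rule regular_interpolation_bounded[OF h], rule that)
  obtain B2 where B2: "\<And>z. Re z > 0 \<Longrightarrow> cmod (z ^ p * g z) \<le> B2"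
    by (rule regular_interpolation_bounded[OF g], rule that)
  have D: "D holomorphic_on {z. Re z > -1/2}"
    using h g unfolding D_def
    by (intro holomorphic_on_diff) (simp_all add: regular_interpolation_def carlsonian_interpolation_def hardy2_def)
  have vals: "h (of_nat n) = of_real (a n)" "g (of_nat n) = of_real (a n)" for n
    using h g by (simp_all add: regular_interpolation_def carlsonian_interpolation_def)
  have D_right: "D z = 0" if "Re z > 0" for z
  proof (rule bounded_vanishing_at_positive_integers[OF _ _ _ that])
    show "D holomorphic_on {z. Re z > 0}"
      by (rule holomorphic_on_subset[OF D]) auto
    show "cmod (D z) \<le> B1 + B2" if "Re z > 0" for z
      unfolding D_def by (rule norm_triangle_le_diff[OF add_mono[OF B1[OF that] B2[OF that]]])
    show "D (of_nat k) = 0" for k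
      by (simp add: D_def vals)
  qed
  have D0: "D z = 0" if "Re z > -1/2" for z
  proof (rule analytic_continuation_open[of "{z. Re z > 0}" "{z. Re z > -1/2}" D "\<lambda>_. 0"])
    show "connected {z. Re z > -1/2}"
      by (intro convex_connected convex_halfspace_Re_gt)
    have "(1::complex) \<in> {z. Re z > 0}"
      by simp
    then show "{z. Re z > 0} \<noteq> {}"
      by blast
  qed (use that D D_right in \<open>auto simp: open_halfspace_Re_gt\<close>)
  have inner: "h z = g z" if "Re z > -1/2" "z \<noteq> 0" for z
    using D0[OF that(1)] that(2) by (simp add: D_def)
  show ?thesis
  proof (cases "Re z > -1/2")
    case True
    then show ?thesis
      using inner[of z] vals[of 0] by (cases "z = 0") auto
  next
    case False
    then have z': "Re z = -1/2" "z \<noteq> 0"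
      using z by auto
    (* The offset 3 keeps the sequence away from 0 even if z = -1/2. *)
    define w where "w = (\<lambda>n. z + of_real (1 / (real n + 3)))"
    have wz: "w \<longlonglongrightarrow> z"
    proof -
      have "(\<lambda>n. 1 / (real n + 3)) \<longlonglongrightarrow> 0"
        by real_asymp
      from tendsto_add[OF tendsto_const tendsto_of_real[OF this], of z] show ?thesis
        by (simp add: w_def)
    qed
    let ?A = "{z. Re z \<ge> -1/2} - {0}"
    have Re_w: "Re (w n) = -1/2 + 1 / (real n + 3)" for n
      by (simp add: w_def z')
    have w3: "1 / (real n + 3) > 0" "1 / (real n + 3) < 1/2" for n
      by (simp_all add: field_simps)
    have w: "w n \<in> ?A" "Re (w n) > -1/2" "w n \<noteq> 0" for n
    proof -
      show "Re (w n) > -1/2"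
        using w3[of n] Re_w[of n] by linarith
      have "Re (w n) \<noteq> 0"
        using w3[of n] Re_w[of n] by linarith
      then show "w n \<noteq> 0"
        by auto
      then show "w n \<in> ?A"
        using \<open>Re (w n) > -1/2\<close> by simp
    qed
    have cont: "continuous_on ?A h" "continuous_on ?A g"
      using h g by (simp_all add: regular_interpolation_def)
    have zA: "z \<in> ?A"
      using z' by simp
    have wA: "\<forall>\<^sub>F n in sequentially. w n \<in> ?A"
      using w by simp
    have "(\<lambda>n. h (w n)) \<longlonglongrightarrow> h z"
      by (rule continuous_on_tendsto_compose[OF cont(1) wz zA wA])
    moreover have "(\<lambda>n. g (w n)) \<longlonglongrightarrow> g z"
      by (rule continuous_on_tendsto_compose[OF cont(2) wz zA wA])
    moreover have "(\<lambda>n. h (w n)) = (\<lambda>n. g (w n))"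
      using inner w by auto
    ultimately show ?thesis
      using LIMSEQ_unique by metis
  qed
qed

lemma regular_interpolation_mono:
  "regular_interpolation p a {} h \<Longrightarrow> regular_interpolation p a {0} h"
  unfolding regular_interpolation_def by (auto intro: holomorphic_on_subset continuous_on_subset)

section \<open>Existence and uniqueness of the regular interpolation\<close>

text \<open>
  The series has real terms, so \<open>F\<close> is real on the interval.
\<close>

lemma newton_series_eq:
  assumes "\<And>x. 0 < x \<Longrightarrow> x < 1 \<Longrightarrow> (\<lambda>k. complex_of_real ((x gchoose k) * (fdiff ^^ k) f 0)) sums F (of_real x)"
    and "0 < x" "x < 1"
  shows "of_real (newton_series f x) = F (of_real x)"
proof -
  have S: "(\<lambda>k. complex_of_real ((x gchoose k) * (fdiff ^^ k) f 0)) sums F (of_real x)"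
    using assms by blast
  have "(\<lambda>k. (x gchoose k) * (fdiff ^^ k) f 0) sums Re (F (of_real x))"
    using sums_Re[OF S] by simp
  moreover have "Im (F (of_real x)) = 0"
    using sums_Im[OF S] sums_unique2[OF _ sums_zero] by auto
  ultimately show ?thesis
    by (simp add: newton_series_def sums_iff complex_eq_iff)
qed

theorem proposition1:
  fixes p :: nat and a :: "nat \<Rightarrow> real"
  assumes "p \<ge> 1"
    and "hausdorff_condition (\<lambda>n. real n ^ p * a n)"
  shows "(exists_unique_regular_interpolation p a {} \<longleftrightarrow> compatible_at_zero p a) \<and>
         exists_unique_regular_interpolation p a {0}"
proof -
  define f where "f = (\<lambda>n. real n ^ p * a n)"
  obtain c K C F where c: "c < -1/2" and F: "F holomorphic_on {z. Re z > c}"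
    and F_nat: "\<And>k. F (of_nat k) = of_real (f k)"
    and L2: "\<And>\<sigma>. \<sigma> > c \<Longrightarrow> (\<integral>\<^sup>+v. ennreal ((cmod (F (Complex \<sigma> v)))\<^sup>2) \<partial>lborel) \<le> ennreal C"
    and bd: "\<And>z \<tau>. Re z > c \<Longrightarrow> \<tau> > 0 \<Longrightarrow> cmod (F z) \<le> (\<tau> * K + 1 / (\<tau> * (2 * (Re z - c)))) / 2"
    and newton: "\<And>x. 0 < x \<Longrightarrow> x < 1 \<Longrightarrow>
           (\<lambda>k. complex_of_real ((x gchoose k) * (fdiff ^^ k) f 0)) sums F (of_real x)"
    by (rule hausdorff_interpolation[OF assms(2)[folded f_def]], rule that)
  define S where "S = {z. Re z > c}"
  have S: "open S" "0 \<in> S" "{z. Re z \<ge> -1/2} \<subseteq> S"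
    using c by (auto simp: S_def open_halfspace_Re_gt)
  have F0: "F 0 = 0"
    using F_nat[of 0] assms(1) by (simp add: f_def)
  define g where "g = (\<lambda>z. if z = 0 then of_real (a 0) else F z / z ^ p)"
  have Fg: "z ^ p * g z = F z" for z
    using assms(1) by (simp add: g_def F0)
  have g_nat: "g (of_nat n) = of_real (a n)" for n
    by (simp add: g_def F_nat f_def)
  have int2: "integrable lborel (\<lambda>v. (cmod (F (Complex \<sigma> v)))\<^sup>2)" if "\<sigma> > c" for \<sigma>
    by (rule integrable_line_L2[OF F that L2[OF that]])
  have carlson: "carlsonian_interpolation p a g"
    unfolding carlsonian_interpolation_def hardy2_def Fg
  proof (intro conjI allI impI exI[of _ C] g_nat L2)
    show "F holomorphic_on {z. Re z > -1/2}"
      using c by (intro holomorphic_on_subset[OF F]) auto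
  qed (use c in simp)
  have decay: "((\<lambda>z. z ^ p * g z) \<longlongrightarrow> 0) (inf at_infinity (principal {z. Re z \<ge> \<delta>}))"
    if "\<delta> > -1/2" for \<delta>
    unfolding Fg using c that by (intro half_plane_decay[OF F _ int2 bd]) auto
  have int1: "integrable lborel (\<lambda>v. Complex \<sigma> v ^ (p - 1) * g (Complex \<sigma> v))" if "\<sigma> \<ge> -1/2" for \<sigma>
  proof (rule integrable_line_L1[OF F _ _ F0 int2, where G = "\<lambda>z. z ^ (p - 1) * g z"])
    fix z :: complex assume "z \<noteq> 0"
    have "z * z ^ (p - 1) = z ^ p"
      using assms(1) by (cases p) simp_all
    then have "z * (z ^ (p - 1) * g z) = F z"
      by (simp only: Fg flip: mult.assoc)
    with \<open>z \<noteq> 0\<close> show "z ^ (p - 1) * g z = F z / z"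
      by (simp add: field_simps)
  qed (use c that in auto)
  have regularI: "regular_interpolation p a E g" if "g holomorphic_on S - E" for E
  proof -
    have "g holomorphic_on {z. Re z > -1/2} - E"
      using S(3) by (intro holomorphic_on_subset[OF that]) auto
    moreover have "continuous_on ({z. Re z \<ge> -1/2} - E) g"
      using S(3) by (intro holomorphic_on_imp_continuous_on holomorphic_on_subset[OF that]) auto
    ultimately show ?thesis
      unfolding regular_interpolation_def Fg
      using carlson decay int1 int2 c by (simp add: Fg)
  qed
  have g_hol: "g holomorphic_on S - {0}"
  proof -
    have "(\<lambda>z. F z / z ^ p) holomorphic_on S - {0}"
      using F unfolding S_def by (intro holomorphic_intros holomorphic_on_subset[OF F]) auto
    then show ?thesis
      by (rule holomorphic_transform) (simp add: g_def)
  qed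
  have reg0: "regular_interpolation p a {0} g"
    by (rule regularI[OF g_hol])
  have unique: "h z = g z" if "regular_interpolation p a {0} h" "Re z \<ge> -1/2" for h z
    by (rule regular_interpolation_unique[OF assms(1) that(1) reg0 that(2)])
  have g_newton: "g (of_real x) = of_real (newton_series f x / x ^ p)" if "0 < x" "x < 1" for x
    using newton_series_eq[OF newton that] that by (simp add: g_def)
  have compat_iff: "compatible_at_zero p a \<longleftrightarrow> ((\<lambda>x. g (of_real x)) \<longlongrightarrow> of_real (a 0)) (at_right 0)"
  proof -
    have "\<forall>\<^sub>F x::real in at_right 0. of_real (newton_series f x / x ^ p) = g (of_real x)"
      unfolding eventually_at_right_field by (intro exI[of _ 1]) (simp add: g_newton)
    then have "((\<lambda>x. complex_of_real (newton_series f x / x ^ p)) \<longlongrightarrow> of_real (a 0)) (at_right 0)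
        \<longleftrightarrow> ((\<lambda>x. g (of_real x)) \<longlongrightarrow> of_real (a 0)) (at_right 0)"
      by (rule filterlim_cong[OF refl refl])
    then show ?thesis
      unfolding compatible_at_zero_def f_def[symmetric] by (simp only: tendsto_of_real_iff)
  qed
  have compat_if: "compatible_at_zero p a" if "regular_interpolation p a {} h" for h
  proof -
    have hg: "h z = g z" if "Re z \<ge> -1/2" for z
      by (rule unique[OF regular_interpolation_mono[OF \<open>regular_interpolation p a {} h\<close>] that])
    have "h holomorphic_on {z. Re z > -1/2}"
      using that by (simp add: regular_interpolation_def)
    then have "continuous_on {z. Re z > -1/2} h"
      by (rule holomorphic_on_imp_continuous_on)
    then have "isCont h 0"
      by (rule continuous_on_interior) (simp add: interior_open open_halfspace_Re_gt)
    then have "((\<lambda>x::real. h (of_real x)) \<longlongrightarrow> h (of_real 0)) (at_right 0)"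
      by (intro isCont_tendsto_compose[of _ h] tendsto_of_real tendsto_ident_at) simp_all
    also have "h (of_real 0) = of_real (a 0)"
      using hg[of 0] g_nat[of 0] by simp
    finally have "((\<lambda>x::real. h (of_real x)) \<longlongrightarrow> of_real (a 0)) (at_right 0)" .
    moreover have "\<forall>\<^sub>F x::real in at_right 0. h (of_real x) = g (of_real x)"
      using eventually_at_right_less[of 0] by eventually_elim (simp add: hg)
    ultimately show ?thesis
      unfolding compat_iff by (rule Lim_transform_eventually)
  qed
  have reg_if: "regular_interpolation p a {} g" if "compatible_at_zero p a"
  proof -
    have "\<forall>\<^sub>F x::real in at_right 0. g (of_real x) = F (of_real x) / of_real x ^ p"
      using eventually_at_right_less[of 0] by eventually_elim (simp add: g_def)
    then have "((\<lambda>x. F (of_real x) / of_real x ^ p) \<longlongrightarrow> of_real (a 0)) (at_right 0)"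
      using that unfolding compat_iff by (rule Lim_transform_eventually[rotated])
    then obtain G where G: "G holomorphic_on S" "\<forall>z\<in>S. F z = z ^ p * G z" "G 0 = of_real (a 0)"
      using divide_power_holomorphic[OF S(1,2) F[folded S_def]] by blast
    have "g holomorphic_on S"
      by (rule holomorphic_transform[OF G(1)]) (use G in \<open>auto simp: g_def\<close>)
    then show ?thesis
      by (intro regularI) simp
  qed
  have "exists_unique_regular_interpolation p a {} \<longleftrightarrow> compatible_at_zero p a"
  proof
    assume "exists_unique_regular_interpolation p a {}"
    then obtain h where "regular_interpolation p a {} h"
      unfolding exists_unique_regular_interpolation_def by (elim exE conjE)
    then show "compatible_at_zero p a"
      by (rule compat_if)
  next
    assume "compatible_at_zero p a"
    then show "exists_unique_regular_interpolation p a {}"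
      unfolding exists_unique_regular_interpolation_def
      by (intro exI[of _ g] conjI reg_if allI impI unique[OF regular_interpolation_mono])
  qed
  moreover have "exists_unique_regular_interpolation p a {0}"
    unfolding exists_unique_regular_interpolation_def
    by (intro exI[of _ g] conjI reg0 allI impI unique)
  ultimately show ?thesis ..
qed

end
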